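(* For all integers $n>0$ and $m\ge 0$, $$\hat E_{n,m}=\Gamma_{n-1,m+1}\,\hat E_{n,m+1}\,(\Gamma^1_{n-1,m+1})^T+\mathcal K_{n-1,m+1}\,(\mathcal K^1_{n-1,m+1})^T .$$ Also, for all integers $n\ge 0$ and $m>0$, $$\hat{\tilde E}_{n,m}=\tilde\Gamma_{n+1,m-1}\,\hat{\tilde E}_{n+1,m}\,(\tilde\Gamma^1_{n+1,m-1})^T+\tilde{\mathcal K}_{n+1,m-1}\,(\tilde{\mathcal K}^1_{n+1,m-1})^T .$$
   Context: Let $\sigma$ be a positive Borel measure on the bi-circle $\mathbb T^2=\{(z,w):|z|=|w|=1\}$ such that for all $n,m\ge0$ the moment (Gram) matrix of the monomials $z^iw^j$, $0\le i\le n$, $0\le j\le m$, in $L^2(\sigma)$ is positive definite. Orthonormal polynomials. For $n,m\ge 0$ and $0\le l\le m$, $\phi^l_{n,m}(z,w)$ is the unique polynomial in the span of the monomials $z^iw^j$ with ($0\le i<n$, $0\le j\le m$) or ($i=n$, $0\le j\le l$), with positive coefficient of $z^nw^l$, of norm $1$ in $L^2(\sigma)$, and orthogonal in $L^2(\sigma)$ to $z^iw^j$ for ($0\le i<n$, $0\le j\le m$) and for ($i=n$, $0\le j<l$). For $0\le l\le n$, $\tilde\phi^l_{n,m}(z,w)$ is defined in the same way with the roles of $z$ and $w$ (and of $n$ and $m$) interchanged: it lies in the span of $z^iw^j$ with ($0\le j<m$, $0\le i\le n$) or ($j=m$, $0\le i\le l$), has positive coefficient of $z^lw^m$, has norm $1$,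 and is orthogonal to $z^iw^j$ for ($0\le j<m$, $0\le i\le n$) and for ($j=m$, $0\le i<l$). Put the column vectors $\Phi_{n,m}=[\phi^m_{n,m},\phi^{m-1}_{n,m},\dots,\phi^0_{n,m}]^T$ (length $m+1$) and $\tilde\Phi_{n,m}=[\tilde\phi^n_{n,m},\dots,\tilde\phi^0_{n,m}]^T$ (length $n+1$). Reverses. For an entry $\phi$ of a vector with index $(n,m)$, $\overleftarrow\phi(z,w)=z^nw^m\,\overline{\phi(1/\bar z,1/\bar w)}$. $\overleftarrow\Phi_{n,m}^T$ and $\overleftarrow{\tilde\Phi}_{n,m}^T$ denote the column vectors of the reverses of the entries of $\Phi_{n,m}$ and $\tilde\Phi_{n,m}$ (in the same order). Inner product. For column vectors of polynomials $X,Y$, $\langle X,Y\rangle=\int_{\mathbb T^2}X\,Y^\dagger\,d\sigma$, where $\dagger$ is conjugate transpose and $T$ is transpose. Recurrence coefficients. $\hat E_{n,m}=\langle z\Phi_{n-1,m},\overleftarrow\Phi_{n-1,m}^T\rangle$, of size $(m+1)\times(m+1)$; $\mathcal K_{n,m}=\langle\Phi_{n,m-1},\tilde\Phi_{n-1,m}\rangle$ and $\mathcal K^1_{n,m}=\langle w\Phi_{n,m-1},\overleftarrow{\tilde\Phi}_{n-1,m}^T\rangle$, of size $m\times n$; $\Gamma_{n,m}=\langle\Phi_{n,m-1},\Phi_{n,m}\rangle$ and $\Gamma^1_{n,m}=\langle w\Phi_{n,m-1},\Phi_{n,m}\rangle$, of size $m\times(m+1)$. The tilde versions are obtained by interchanging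 the roles of $z,w$, of $n,m$, and of tilded and untilded polynomials: $\hat{\tilde E}_{n,m}=\langle w\tilde\Phi_{n,m-1},\overleftarrow{\tilde\Phi}_{n,m-1}^T\rangle$, of size $(n+1)\times(n+1)$; $\tilde{\mathcal K}_{n,m}=\langle\tilde\Phi_{n-1,m},\Phi_{n,m-1}\rangle$ and $\tilde{\mathcal K}^1_{n,m}=\langle z\tilde\Phi_{n-1,m},\overleftarrow{\Phi}_{n,m-1}^T\rangle$, of size $n\times m$; $\tilde\Gamma_{n,m}=\langle\tilde\Phi_{n-1,m},\tilde\Phi_{n,m}\rangle$ and $\tilde\Gamma^1_{n,m}=\langle z\tilde\Phi_{n-1,m},\tilde\Phi_{n,m}\rangle$, of size $n\times(n+1)$. Convention: matrices with an index equal to $0$ that makes them empty (e.g. $\mathcal K_{0,m}$, of size $m\times 0$) are empty, and products through an empty dimension are zero matrices. *)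

theory Defs
  imports
    "HOL-Analysis.Analysis"
    "HOL-Library.Poly_Mapping"
    "Jordan_Normal_Form.Matrix"
begin

definition bicircle :: "(complex \<times> complex) set" where
  "bicircle = sphere 0 1 \<times> sphere 0 1"

definition inner_prod ::
    "(complex \<times> complex) measure \<Rightarrow> (complex \<times> complex \<Rightarrow> complex) \<Rightarrow> (complex \<times> complex \<Rightarrow> complex) \<Rightarrow> complex"
  where "inner_prod \<sigma> f g = (\<integral>x. f x * cnj (g x) \<partial>\<sigma>)"

definition monomial_fun :: "nat \<times> nat \<Rightarrow> complex \<times> complex \<Rightarrow> complex" where
  "monomial_fun k x = fst x ^ fst k * snd x ^ snd k"

text \<open>A matrix whose rows and columns are both indexed by the finite set \<open>I\<close>; positive
  definiteness does not depend on how \<open>I\<close> is enumerated.\<close>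

definition pos_definite :: "'i set \<Rightarrow> ('i \<Rightarrow> 'i \<Rightarrow> complex) \<Rightarrow> bool" where
  "pos_definite I A \<longleftrightarrow>
    (\<forall>v. (\<exists>i\<in>I. v i \<noteq> 0) \<longrightarrow>
      (\<Sum>i\<in>I. \<Sum>j\<in>I. v i * A i j * cnj (v j)) \<in> \<real> \<and>
      0 < Re (\<Sum>i\<in>I. \<Sum>j\<in>I. v i * A i j * cnj (v j)))"

text \<open>Finiteness only makes explicit that the moments exist: the Bochner integral of the
  constant 1 is 0 for an infinite measure, which positive definiteness already excludes.\<close>

definition admissible_measure :: "(complex \<times> complex) measure \<Rightarrow> bool" where
  "admissible_measure \<sigma> \<longleftrightarrow>
    sets \<sigma> = sets (restrict_space borel bicircle) \<and> finite_measure \<sigma> \<and>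
    (\<forall>n m. pos_definite ({0..n} \<times> {0..m})
      (\<lambda>k l. inner_prod \<sigma> (monomial_fun k) (monomial_fun l)))"

text \<open>A polynomial in \<open>z, w\<close> is its finitely supported coefficient family;
  the key \<open>(i, j)\<close> belongs to the monomial \<open>z^i w^j\<close>.\<close>

type_synonym poly_zw = "(nat \<times> nat) \<Rightarrow>\<^sub>0 complex"

definition eval_zw :: "poly_zw \<Rightarrow> complex \<times> complex \<Rightarrow> complex" where
  "eval_zw p x = (\<Sum>k\<in>Poly_Mapping.keys p. Poly_Mapping.lookup p k * monomial_fun k x)"

text \<open>\<open>A\<close> is the set of exponents preceding the leading exponent \<open>k\<close>.\<close>

definition is_orthonormal_poly ::
    "(complex \<times> complex) measure \<Rightarrow> (nat \<times> nat) set \<Rightarrow> nat \<times> nat \<Rightarrow> poly_zw \<Rightarrow> bool" where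
  "is_orthonormal_poly \<sigma> A k p \<longleftrightarrow>
    Poly_Mapping.keys p \<subseteq> insert k A \<and>
    Poly_Mapping.lookup p k \<in> \<real> \<and> 0 < Re (Poly_Mapping.lookup p k) \<and>
    inner_prod \<sigma> (eval_zw p) (eval_zw p) = 1 \<and>
    (\<forall>a\<in>A. inner_prod \<sigma> (eval_zw p) (monomial_fun a) = 0)"

definition phi :: "(complex \<times> complex) measure \<Rightarrow> nat \<Rightarrow> nat \<Rightarrow> nat \<Rightarrow> poly_zw" where
  "phi \<sigma> n m l =
    (THE p. is_orthonormal_poly \<sigma> ({0..<n} \<times> {0..m} \<union> {n} \<times> {0..<l}) (n, l) p)"

definition phi_tilde :: "(complex \<times> complex) measure \<Rightarrow> nat \<Rightarrow> nat \<Rightarrow> nat \<Rightarrow> poly_zw" where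
  "phi_tilde \<sigma> n m l =
    (THE p. is_orthonormal_poly \<sigma> ({0..n} \<times> {0..<m} \<union> {0..<l} \<times> {m}) (l, m) p)"

text \<open>A column vector of functions is a sequence of which only an initial segment is
  meaningful: the first \<open>m + 1\<close> entries of \<open>Phi \<sigma> n m\<close> and the first \<open>n + 1\<close> entries of
  \<open>Phi_tilde \<sigma> n m\<close>. The lengths are passed to \<open>inner_mat\<close>, so that they can be 0.\<close>

type_synonym fun_vec = "nat \<Rightarrow> complex \<times> complex \<Rightarrow> complex"

definition Phi :: "(complex \<times> complex) measure \<Rightarrow> nat \<Rightarrow> nat \<Rightarrow> fun_vec" where
  "Phi \<sigma> n m i = eval_zw (phi \<sigma> n m (m - i))"

definition Phi_tilde :: "(complex \<times> complex) measure \<Rightarrow> nat \<Rightarrow> nat \<Rightarrow> fun_vec" where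
  "Phi_tilde \<sigma> n m i = eval_zw (phi_tilde \<sigma> n m (n - i))"

definition z_times :: "fun_vec \<Rightarrow> fun_vec" where
  "z_times X i x = fst x * X i x"

definition w_times :: "fun_vec \<Rightarrow> fun_vec" where
  "w_times X i x = snd x * X i x"

definition reverse_vec :: "nat \<Rightarrow> nat \<Rightarrow> fun_vec \<Rightarrow> fun_vec" where
  "reverse_vec n m X i x =
    fst x ^ n * snd x ^ m * cnj (X i (1 / cnj (fst x), 1 / cnj (snd x)))"

definition inner_mat ::
    "(complex \<times> complex) measure \<Rightarrow> nat \<Rightarrow> nat \<Rightarrow> fun_vec \<Rightarrow> fun_vec \<Rightarrow> complex Matrix.mat" where
  "inner_mat \<sigma> r s X Y = Matrix.mat r s (\<lambda>(i, j). inner_prod \<sigma> (X i) (Y j))"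

text \<open>An index \<open>n - 1\<close> with \<open>n = 0\<close> (or \<open>m - 1\<close> with \<open>m = 0\<close>) is truncated below. In
  \<open>K\<close>, \<open>K1\<close>, \<open>Gam\<close>, \<open>Gam1\<close> and their tilde versions the matrix is then empty, so no entry
  depends on it; \<open>E_hat \<sigma> n m\<close> is meaningful for \<open>n > 0\<close> only, and
  \<open>E_hat_tilde \<sigma> n m\<close> for \<open>m > 0\<close> only.\<close>

definition E_hat :: "(complex \<times> complex) measure \<Rightarrow> nat \<Rightarrow> nat \<Rightarrow> complex Matrix.mat" where
  "E_hat \<sigma> n m = inner_mat \<sigma> (m + 1) (m + 1)
    (z_times (Phi \<sigma> (n - 1) m)) (reverse_vec (n - 1) m (Phi \<sigma> (n - 1) m))"

definition K :: "(complex \<times> complex) measure \<Rightarrow> nat \<Rightarrow> nat \<Rightarrow> complex Matrix.mat" where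
  "K \<sigma> n m = inner_mat \<sigma> m n (Phi \<sigma> n (m - 1)) (Phi_tilde \<sigma> (n - 1) m)"

definition K1 :: "(complex \<times> complex) measure \<Rightarrow> nat \<Rightarrow> nat \<Rightarrow> complex Matrix.mat" where
  "K1 \<sigma> n m = inner_mat \<sigma> m n
    (w_times (Phi \<sigma> n (m - 1))) (reverse_vec (n - 1) m (Phi_tilde \<sigma> (n - 1) m))"

definition Gam :: "(complex \<times> complex) measure \<Rightarrow> nat \<Rightarrow> nat \<Rightarrow> complex Matrix.mat" where
  "Gam \<sigma> n m = inner_mat \<sigma> m (m + 1) (Phi \<sigma> n (m - 1)) (Phi \<sigma> n m)"

definition Gam1 :: "(complex \<times> complex) measure \<Rightarrow> nat \<Rightarrow> nat \<Rightarrow> complex Matrix.mat" where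
  "Gam1 \<sigma> n m = inner_mat \<sigma> m (m + 1) (w_times (Phi \<sigma> n (m - 1))) (Phi \<sigma> n m)"

definition E_hat_tilde :: "(complex \<times> complex) measure \<Rightarrow> nat \<Rightarrow> nat \<Rightarrow> complex Matrix.mat" where
  "E_hat_tilde \<sigma> n m = inner_mat \<sigma> (n + 1) (n + 1)
    (w_times (Phi_tilde \<sigma> n (m - 1))) (reverse_vec n (m - 1) (Phi_tilde \<sigma> n (m - 1)))"

definition K_tilde :: "(complex \<times> complex) measure \<Rightarrow> nat \<Rightarrow> nat \<Rightarrow> complex Matrix.mat" where
  "K_tilde \<sigma> n m = inner_mat \<sigma> n m (Phi_tilde \<sigma> (n - 1) m) (Phi \<sigma> n (m - 1))"

definition K1_tilde :: "(complex \<times> complex) measure \<Rightarrow> nat \<Rightarrow> nat \<Rightarrow> complex Matrix.mat" where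
  "K1_tilde \<sigma> n m = inner_mat \<sigma> n m
    (z_times (Phi_tilde \<sigma> (n - 1) m)) (reverse_vec n (m - 1) (Phi \<sigma> n (m - 1)))"

definition Gam_tilde :: "(complex \<times> complex) measure \<Rightarrow> nat \<Rightarrow> nat \<Rightarrow> complex Matrix.mat" where
  "Gam_tilde \<sigma> n m = inner_mat \<sigma> n (n + 1) (Phi_tilde \<sigma> (n - 1) m) (Phi_tilde \<sigma> n m)"

definition Gam1_tilde :: "(complex \<times> complex) measure \<Rightarrow> nat \<Rightarrow> nat \<Rightarrow> complex Matrix.mat" where
  "Gam1_tilde \<sigma> n m = inner_mat \<sigma> n (n + 1) (z_times (Phi_tilde \<sigma> (n - 1) m)) (Phi_tilde \<sigma> n m)"

end

theory Submission
  imports Defs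
begin

text \<open>Write \<open>N = n - 1\<close>, \<open>M = m + 1\<close>. In \<open>span (z^i w^j | i \<le> N, j \<le> M)\<close> the orthogonal complement of
  \<open>span (z^i w^j | i < N, j < M)\<close> has the orthonormal basis \<open>Phi N M\<close>, \<open>Phi_tilde (N - 1) M\<close>, and that of
  \<open>w * span (z^i w^j | i < N, j < M)\<close> has the orthonormal basis \<open>Phi N M\<close>, reverse of \<open>Phi_tilde (N - 1) M\<close>.
  Expanding \<open>Phi N m\<close> in the first and \<open>w * Phi N m\<close> in the second basis produces the coefficients
  \<open>Gam\<close>, \<open>K\<close> and \<open>Gam1\<close>, \<open>K1\<close>. The reverse of \<open>w * Phi N m\<close> at \<open>(N, M)\<close> is the reverse of \<open>Phi N m\<close>
  at \<open>(N, m)\<close>, so substituting both expansions into \<open>E_hat n m\<close> leaves only the two stated products: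
  the mixed terms are inner products of orthogonal layers.\<close>

section \<open>Polynomial functions on the bicircle with prescribed exponents\<close>

text \<open>Agreement is required on the bicircle only. The measure lives there, and a reversed
  polynomial, defined through \<open>1 / cnj\<close>, is a polynomial function there but in general
  not at points with a zero coordinate.\<close>

definition monomial_span :: "(nat \<times> nat) set \<Rightarrow> (complex \<times> complex \<Rightarrow> complex) \<Rightarrow> bool" where
  "monomial_span S f \<longleftrightarrow>
    (\<exists>v. \<forall>x\<in>bicircle. f x = (\<Sum>k\<in>S. v k * monomial_fun k x))"

lemma compact_bicircle: "compact bicircle"
  by (simp add: bicircle_def compact_Times)

lemma norm_bicircle:
  assumes "x \<in> bicircle"
  shows "norm (fst x) = 1" "norm (snd x) = 1"
  using assms by (auto simp: bicircle_def)

lemma mult_cnj_unimodular: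
  fixes a :: complex
  assumes "norm a = 1"
  shows "a * cnj a = 1"
  using assms by (simp add: complex_norm_square[symmetric])

lemma continuous_on_monomial_fun [continuous_intros]: "continuous_on S (monomial_fun k)"
  unfolding monomial_fun_def by (intro continuous_intros)

lemma continuous_on_monomial_span:
  assumes "monomial_span S f"
  shows "continuous_on bicircle f"
proof -
  from assms obtain v where v: "\<forall>x\<in>bicircle. f x = (\<Sum>k\<in>S. v k * monomial_fun k x)"
    by (auto simp: monomial_span_def)
  have "continuous_on bicircle (\<lambda>x. \<Sum>k\<in>S. v k * monomial_fun k x)"
    by (intro continuous_intros)
  then show ?thesis
    by (rule continuous_on_eq) (use v in simp)
qed

lemma monomial_span_cong:
  assumes "monomial_span S g" "\<And>x. x \<in> bicircle \<Longrightarrow> f x = g x"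
  shows "monomial_span S f"
  using assms by (simp add: monomial_span_def)

lemma monomial_span_monomial:
  assumes "finite S" "k \<in> S"
  shows "monomial_span S (monomial_fun k)"
  unfolding monomial_span_def
proof (intro exI ballI)
  fix x
  have "(\<Sum>l\<in>S. (if l = k then 1 else 0) * monomial_fun l x)
      = (\<Sum>l\<in>{k}. (if l = k then 1 else 0) * monomial_fun l x)"
    by (rule sum.mono_neutral_right) (use assms in auto)
  then show "monomial_fun k x = (\<Sum>l\<in>S. (if l = k then 1 else 0) * monomial_fun l x)"
    by simp
qed

lemma monomial_span_add:
  assumes "monomial_span S f" "monomial_span S g"
  shows "monomial_span S (\<lambda>x. f x + g x)"
proof -
  obtain u where "\<forall>x\<in>bicircle. f x = (\<Sum>k\<in>S. u k * monomial_fun k x)"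
    using assms by (auto simp: monomial_span_def)
  moreover obtain v where "\<forall>x\<in>bicircle. g x = (\<Sum>k\<in>S. v k * monomial_fun k x)"
    using assms by (auto simp: monomial_span_def)
  ultimately show ?thesis
    unfolding monomial_span_def
    by (intro exI[of _ "\<lambda>k. u k + v k"]) (simp add: algebra_simps sum.distrib)
qed

lemma monomial_span_scale:
  assumes "monomial_span S f"
  shows "monomial_span S (\<lambda>x. c * f x)"
proof -
  obtain u where "\<forall>x\<in>bicircle. f x = (\<Sum>k\<in>S. u k * monomial_fun k x)"
    using assms by (auto simp: monomial_span_def)
  then show ?thesis
    unfolding monomial_span_def
    by (intro exI[of _ "\<lambda>k. c * u k"]) (simp add: algebra_simps sum_distrib_left)
qed

lemma monomial_span_diff:
  assumes "monomial_span S f" "monomial_span S g"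
  shows "monomial_span S (\<lambda>x. f x - g x)"
  using monomial_span_add[OF assms(1) monomial_span_scale[OF assms(2), of "- 1"]] by simp

lemma monomial_span_sum:
  assumes "\<And>i. i \<in> I \<Longrightarrow> monomial_span S (F i)"
  shows "monomial_span S (\<lambda>x. \<Sum>i\<in>I. c i * F i x)"
  using assms
proof (induction I rule: infinite_finite_induct)
  case (insert i I)
  then show ?case
    using monomial_span_add[OF monomial_span_scale, of S "F i" _ "c i"] by simp
\<comment> \<open>For an infinite index set, as for the empty one, the sum is 0 by default.\<close>
qed (auto simp: monomial_span_def intro!: exI[of _ "\<lambda>_. 0"])

lemma monomial_span_mono:
  assumes "monomial_span S f" "finite T" "S \<subseteq> T"
  shows "monomial_span T f"
proof -
  obtain u where u: "\<And>x. x \<in> bicircle \<Longrightarrow> f x = (\<Sum>k\<in>S. u k * monomial_fun k x)"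
    using assms by (auto simp: monomial_span_def)
  have "monomial_span T (\<lambda>x. \<Sum>k\<in>S. u k * monomial_fun k x)"
    using assms by (intro monomial_span_sum monomial_span_monomial) auto
  then show ?thesis
    using u by (rule monomial_span_cong)
qed

lemma eval_zw_eq_sum:
  assumes "finite S" "Poly_Mapping.keys p \<subseteq> S"
  shows "eval_zw p x = (\<Sum>k\<in>S. Poly_Mapping.lookup p k * monomial_fun k x)"
  unfolding eval_zw_def
  using assms by (intro sum.mono_neutral_left) (auto simp: in_keys_iff)

lemma monomial_span_eval_zw:
  assumes "finite S" "Poly_Mapping.keys p \<subseteq> S"
  shows "monomial_span S (eval_zw p)"
  using eval_zw_eq_sum[OF assms] by (auto simp: monomial_span_def)

text \<open>The last clause says that the \<open>X i\<close> generate the monomials in \<open>B\<close> modulo those in \<open>A\<close>; it is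
  put in this dual form because that composes along chains \<open>A \<subseteq> B \<subseteq> C\<close> without linear algebra.\<close>

definition orthonormal_complement ::
    "(complex \<times> complex) measure \<Rightarrow> (nat \<times> nat) set \<Rightarrow> (nat \<times> nat) set \<Rightarrow> nat \<Rightarrow> fun_vec \<Rightarrow> bool"
  where "orthonormal_complement \<sigma> A B r X \<longleftrightarrow>
    (\<forall>i<r. monomial_span B (X i)) \<and>
    (\<forall>i<r. \<forall>k\<in>A. inner_prod \<sigma> (X i) (monomial_fun k) = 0) \<and>
    (\<forall>i<r. \<forall>j<r. inner_prod \<sigma> (X i) (X j) = (if i = j then 1 else 0)) \<and>
    (\<forall>f. continuous_on bicircle f \<longrightarrow>
      (\<forall>k\<in>A. inner_prod \<sigma> f (monomial_fun k) = 0) \<longrightarrow>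
      (\<forall>i<r. inner_prod \<sigma> f (X i) = 0) \<longrightarrow>
      (\<forall>k\<in>B. inner_prod \<sigma> f (monomial_fun k) = 0))"

section \<open>The inner product of an admissible measure\<close>

context
  fixes \<sigma> :: "(complex \<times> complex) measure"
  assumes admissible: "admissible_measure \<sigma>"
begin

abbreviation ip (infixl "\<bullet>\<bullet>" 70) where "f \<bullet>\<bullet> g \<equiv> inner_prod \<sigma> f g"

lemma space_eq_bicircle: "space \<sigma> = bicircle"
  using admissible sets_eq_imp_space_eq[of \<sigma> "restrict_space borel bicircle"]
  by (simp add: admissible_measure_def space_restrict_space)

text \<open>Compactness of the bicircle bounds \<open>f\<close>, and the measure is finite.
  Linearity of the inner product rests on this.\<close>

lemma integrable_continuous:
  fixes f :: "complex \<times> complex \<Rightarrow> complex"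
  assumes "continuous_on bicircle f"
  shows "integrable \<sigma> f"
proof -
  interpret finite_measure \<sigma>
    using admissible by (simp add: admissible_measure_def)
  have sets: "sets \<sigma> = sets (restrict_space borel bicircle)"
    using admissible by (simp add: admissible_measure_def)
  have meas: "f \<in> borel_measurable \<sigma>"
    unfolding measurable_cong_sets[OF sets refl]
    using assms by (rule borel_measurable_continuous_on_restrict)
  have "bounded (f ` bicircle)"
    using compact_continuous_image[OF assms compact_bicircle] by (rule compact_imp_bounded)
  then obtain B where "\<And>x. x \<in> bicircle \<Longrightarrow> norm (f x) \<le> B"
    by (auto simp: bounded_iff)
  then show ?thesis
    using meas by (intro integrable_const_bound[of _ B]) (auto simp: space_eq_bicircle)
qed

text \<open>Only the integrand is compared, not each factor, so unimodular factors and conjugates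
  can be moved from one argument to the other.\<close>

lemma inner_prod_cong:
  assumes "\<And>x. x \<in> bicircle \<Longrightarrow> f x * cnj (g x) = f' x * cnj (g' x)"
  shows "f \<bullet>\<bullet> g = f' \<bullet>\<bullet> g'"
  unfolding inner_prod_def
  by (rule Bochner_Integration.integral_cong) (simp_all add: space_eq_bicircle assms)

lemma inner_prod_commute: "g \<bullet>\<bullet> f = cnj (f \<bullet>\<bullet> g)"
  unfolding inner_prod_def Bochner_Integration.integral_cnj[symmetric] by (simp add: mult.commute)

lemma inner_prod_add_left:
  assumes "continuous_on bicircle f" "continuous_on bicircle g" "continuous_on bicircle h"
  shows "(\<lambda>x. f x + g x) \<bullet>\<bullet> h = f \<bullet>\<bullet> h + g \<bullet>\<bullet> h"
  unfolding inner_prod_def distrib_right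
  by (intro Bochner_Integration.integral_add integrable_continuous continuous_intros assms)

lemma inner_prod_diff_left:
  assumes "continuous_on bicircle f" "continuous_on bicircle g" "continuous_on bicircle h"
  shows "(\<lambda>x. f x - g x) \<bullet>\<bullet> h = f \<bullet>\<bullet> h - g \<bullet>\<bullet> h"
  unfolding inner_prod_def left_diff_distrib
  by (intro Bochner_Integration.integral_diff integrable_continuous continuous_intros assms)

lemma inner_prod_scale_left: "(\<lambda>x. c * f x) \<bullet>\<bullet> h = c * (f \<bullet>\<bullet> h)"
  unfolding inner_prod_def mult.assoc by (rule Bochner_Integration.integral_mult_right_zero)

lemma inner_prod_sum_left:
  assumes "\<And>i. i \<in> I \<Longrightarrow> continuous_on bicircle (F i)" "continuous_on bicircle h"
  shows "(\<lambda>x. \<Sum>i\<in>I. c i * F i x) \<bullet>\<bullet> h = (\<Sum>i\<in>I. c i * (F i \<bullet>\<bullet> h))"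
proof -
  have "(\<integral>x. (\<Sum>i\<in>I. c i * (F i x * cnj (h x))) \<partial>\<sigma>) = (\<Sum>i\<in>I. \<integral>x. c i * (F i x * cnj (h x)) \<partial>\<sigma>)"
    by (intro Bochner_Integration.integral_sum integrable_continuous continuous_intros assms)
  then show ?thesis
    unfolding inner_prod_def sum_distrib_right mult.assoc by simp
qed

lemma inner_prod_sum_right:
  assumes "\<And>i. i \<in> I \<Longrightarrow> continuous_on bicircle (F i)" "continuous_on bicircle h"
  shows "h \<bullet>\<bullet> (\<lambda>x. \<Sum>i\<in>I. c i * F i x) = (\<Sum>i\<in>I. cnj (c i) * (h \<bullet>\<bullet> F i))"
proof -
  have "h \<bullet>\<bullet> (\<lambda>x. \<Sum>i\<in>I. c i * F i x) = cnj (\<Sum>i\<in>I. c i * (F i \<bullet>\<bullet> h))"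
    by (subst inner_prod_commute, subst inner_prod_sum_left[OF assms]) simp_all
  also have "\<dots> = (\<Sum>i\<in>I. cnj (c i) * (h \<bullet>\<bullet> F i))"
    unfolding cnj_sum complex_cnj_mult using inner_prod_commute[of h] by simp
  finally show ?thesis .
qed

lemma inner_prod_monomial_span_eq_0:
  assumes "continuous_on bicircle f" "\<And>k. k \<in> S \<Longrightarrow> f \<bullet>\<bullet> monomial_fun k = 0" "monomial_span S g"
  shows "f \<bullet>\<bullet> g = 0"
proof -
  obtain v where v: "\<forall>x\<in>bicircle. g x = (\<Sum>k\<in>S. v k * monomial_fun k x)"
    using assms by (auto simp: monomial_span_def)
  have "f \<bullet>\<bullet> g = f \<bullet>\<bullet> (\<lambda>x. \<Sum>k\<in>S. v k * monomial_fun k x)"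
    by (rule inner_prod_cong) (simp add: v)
  also have "\<dots> = 0"
    using assms by (subst inner_prod_sum_right) (auto intro!: continuous_intros)
  finally show ?thesis .
qed

lemma inner_prod_self: "f \<bullet>\<bullet> f = of_real (\<integral>x. (norm (f x))\<^sup>2 \<partial>\<sigma>)"
  unfolding inner_prod_def complex_norm_square[symmetric] integral_complex_of_real[symmetric] ..

text \<open>Zero norm makes \<open>f\<close> vanish almost everywhere, so \<open>g\<close> can be
  arbitrary and no Cauchy-Schwarz inequality is needed.\<close>

lemma inner_prod_self_eq_0:
  assumes "continuous_on bicircle f" "f \<bullet>\<bullet> f = 0"
  shows "f \<bullet>\<bullet> g = 0"
proof -
  have "integrable \<sigma> (\<lambda>x. f x * cnj (f x))"
    by (intro integrable_continuous continuous_intros assms)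
  then have "integrable \<sigma> (\<lambda>x. (norm (f x))\<^sup>2)"
    unfolding complex_norm_square[symmetric] complex_of_real_integrable_eq .
  moreover have "(\<integral>x. (norm (f x))\<^sup>2 \<partial>\<sigma>) = 0"
    using assms(2) unfolding inner_prod_self by (simp only: of_real_eq_0_iff)
  ultimately have "AE x in \<sigma>. (norm (f x))\<^sup>2 = 0"
    using integral_nonneg_eq_0_iff_AE[of \<sigma> "\<lambda>x. (norm (f x))\<^sup>2"] by simp
  then have "AE x in \<sigma>. f x * cnj (g x) = 0"
    by eventually_elim simp
  then show ?thesis
    unfolding inner_prod_def by (rule integral_eq_zero_AE)
qed

section \<open>Linear independence of monomials and existence and uniqueness of orthonormal
  polynomials\<close>

text \<open>Positive definiteness is given for rectangles of exponents; a general finite set is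
  enclosed in one. The variable \<open>f\<close> merely names the combination with coefficients
  \<open>v\<close>.\<close>

lemma monomials_independent:
  assumes "finite S" "\<And>f. (\<And>x. f x = (\<Sum>k\<in>S. v k * monomial_fun k x)) \<Longrightarrow> f \<bullet>\<bullet> f = 0" "k \<in> S"
  shows "v k = 0"
proof (rule ccontr)
  assume nz: "v k \<noteq> 0"
  define n where "n = Max (fst ` S)"
  define m where "m = Max (snd ` S)"
  \<comment> \<open>The coefficients are extended by zero from \<open>S\<close> to the rectangle,
    which does not change the function.\<close>
  define u where "u = (\<lambda>l. if l \<in> S then v l else 0)"
  let ?G = "{0..n} \<times> {0..m}"
  have sub: "S \<subseteq> ?G"
  proof
    fix l assume "l \<in> S"
    then have "fst l \<le> n" "snd l \<le> m"
      using assms(1) by (auto simp: n_def m_def)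
    then show "l \<in> ?G" by (cases l) auto
  qed
  define f where "f = (\<lambda>x. \<Sum>k\<in>?G. u k * monomial_fun k x)"
  have f: "f x = (\<Sum>k\<in>S. v k * monomial_fun k x)" for x
    unfolding f_def by (rule sum.mono_neutral_cong_right) (use sub in \<open>auto simp: u_def\<close>)
  \<comment> \<open>By sesquilinearity the Gram form at \<open>u\<close> is the squared norm of
    \<open>f\<close>, which is 0 by hypothesis.\<close>
  have "(\<Sum>i\<in>?G. \<Sum>j\<in>?G. u i * (monomial_fun i \<bullet>\<bullet> monomial_fun j) * cnj (u j))
      = (\<Sum>i\<in>?G. u i * (monomial_fun i \<bullet>\<bullet> f))"
  proof (rule sum.cong[OF refl])
    fix i
    have "monomial_fun i \<bullet>\<bullet> f = (\<Sum>j\<in>?G. cnj (u j) * (monomial_fun i \<bullet>\<bullet> monomial_fun j))"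
      unfolding f_def by (rule inner_prod_sum_right) (rule continuous_on_monomial_fun)+
    then show "(\<Sum>j\<in>?G. u i * (monomial_fun i \<bullet>\<bullet> monomial_fun j) * cnj (u j))
        = u i * (monomial_fun i \<bullet>\<bullet> f)"
      by (simp add: sum_distrib_left mult_ac)
  qed
  also have "\<dots> = (\<lambda>x. \<Sum>k\<in>?G. u k * monomial_fun k x) \<bullet>\<bullet> f"
    by (rule inner_prod_sum_left[symmetric]) (auto simp: f_def intro!: continuous_intros)
  also have "\<dots> = f \<bullet>\<bullet> f" by (simp only: f_def)
  also have "\<dots> = 0" by (rule assms(2)) (rule f)
  finally have zero: "(\<Sum>i\<in>?G. \<Sum>j\<in>?G. u i * (monomial_fun i \<bullet>\<bullet> monomial_fun j) * cnj (u j)) = 0" .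
  have "\<exists>i\<in>?G. u i \<noteq> 0"
    using nz assms(3) sub by (intro bexI[of _ k]) (auto simp: u_def)
  moreover have "pos_definite ?G (\<lambda>k l. monomial_fun k \<bullet>\<bullet> monomial_fun l)"
    using admissible by (simp add: admissible_measure_def)
  ultimately have "0 < Re (\<Sum>i\<in>?G. \<Sum>j\<in>?G. u i * (monomial_fun i \<bullet>\<bullet> monomial_fun j) * cnj (u j))"
    unfolding pos_definite_def by blast
  then show False unfolding zero by simp
qed

text \<open>The difference has coefficient 1 at \<open>k\<close>, against independence if its norm
  were 0. This permits the divisions in the Gram-Schmidt process.\<close>

lemma monomial_minus_span_norm_nonzero:
  assumes "finite A" "k \<notin> A" "monomial_span A q"
  shows "(\<lambda>x. monomial_fun k x - q x) \<bullet>\<bullet> (\<lambda>x. monomial_fun k x - q x) \<noteq> 0"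
proof
  assume *: "(\<lambda>x. monomial_fun k x - q x) \<bullet>\<bullet> (\<lambda>x. monomial_fun k x - q x) = 0"
  obtain u where u: "\<forall>x\<in>bicircle. q x = (\<Sum>l\<in>A. u l * monomial_fun l x)"
    using assms by (auto simp: monomial_span_def)
  define v where "v = (\<lambda>l. if l = k then 1 else - u l)"
  have "v k = 0"
  proof (rule monomials_independent[of "insert k A"])
    fix f assume f: "\<And>x. f x = (\<Sum>l\<in>insert k A. v l * monomial_fun l x)"
    have "f x = monomial_fun k x - q x" if "x \<in> bicircle" for x
    proof -
      have "(\<Sum>l\<in>A. v l * monomial_fun l x) = (\<Sum>l\<in>A. - (u l * monomial_fun l x))"
        using assms by (intro sum.cong) (auto simp: v_def)
      then show ?thesis
        using assms that u by (simp add: f v_def sum_negf)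
    qed
    then have "f \<bullet>\<bullet> f = (\<lambda>x. monomial_fun k x - q x) \<bullet>\<bullet> (\<lambda>x. monomial_fun k x - q x)"
      by (intro inner_prod_cong) simp
    then show "f \<bullet>\<bullet> f = 0" using * by simp
  qed (use assms in auto)
  then show False by (simp add: v_def)
qed

text \<open>Gram-Schmidt as an induction on \<open>A\<close>. The function \<open>f\<close> is
  generalized because the induction hypothesis is also applied to the new monomial.\<close>

lemma orthogonal_projection_exists:
  assumes "finite A" "continuous_on bicircle f"
  shows "\<exists>q. monomial_span A q \<and> (\<forall>k\<in>A. (\<lambda>x. f x - q x) \<bullet>\<bullet> monomial_fun k = 0)"
  using assms
proof (induction A arbitrary: f rule: finite_induct)
  case empty
  show ?case by (auto simp: monomial_span_def)
next
  case (insert a A)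
  obtain q where q: "monomial_span A q"
    "\<And>k. k \<in> A \<Longrightarrow> (\<lambda>x. f x - q x) \<bullet>\<bullet> monomial_fun k = 0"
    using insert by meson
  have "continuous_on bicircle (monomial_fun a)" by (intro continuous_intros)
  then obtain p where p: "monomial_span A p"
    "\<And>k. k \<in> A \<Longrightarrow> (\<lambda>x. monomial_fun a x - p x) \<bullet>\<bullet> monomial_fun k = 0"
    using insert by meson
  \<comment> \<open>The part of the new monomial orthogonal to \<open>A\<close>; adding the
    component of \<open>f - q\<close> along it corrects the old projection \<open>q\<close>.\<close>
  define e where "e = (\<lambda>x. monomial_fun a x - p x)"
  define c where "c = ((\<lambda>x. f x - q x) \<bullet>\<bullet> e) / (e \<bullet>\<bullet> e)"
  define q' where "q' = (\<lambda>x. q x + c * e x)"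
  have e_ne: "e \<bullet>\<bullet> e \<noteq> 0"
    unfolding e_def using insert p by (intro monomial_minus_span_norm_nonzero) auto
  have span': "monomial_span (insert a A) q" "monomial_span (insert a A) p"
    using monomial_span_mono[of A _ "insert a A"] insert q p by auto
  have span_e: "monomial_span (insert a A) e"
    unfolding e_def using span' insert by (intro monomial_span_diff monomial_span_monomial) auto
  note cont = continuous_on_monomial_span[OF q(1)] continuous_on_monomial_span[OF p(1)]
    continuous_on_monomial_span[OF span_e] insert.prems
  have span_q': "monomial_span (insert a A) q'"
    unfolding q'_def by (intro monomial_span_add monomial_span_scale span' span_e)
  have eq: "(\<lambda>x. f x - q' x) \<bullet>\<bullet> g = (\<lambda>x. f x - q x) \<bullet>\<bullet> g - c * (e \<bullet>\<bullet> g)"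
    if "continuous_on bicircle g" for g
  proof -
    have "(\<lambda>x. f x - q' x) = (\<lambda>x. (f x - q x) - c * e x)"
      by (simp add: q'_def algebra_simps)
    then show ?thesis
      using that cont
      by (simp add: inner_prod_diff_left[of "\<lambda>x. f x - q x" "\<lambda>x. c * e x"] inner_prod_scale_left
          continuous_intros)
  qed
  have orth_A: "(\<lambda>x. f x - q' x) \<bullet>\<bullet> monomial_fun k = 0" if "k \<in> A" for k
    using that q(2) p(2) by (subst eq) (auto simp: e_def intro!: continuous_intros)
  have cont': "continuous_on bicircle (\<lambda>x. f x - q' x)"
    unfolding q'_def by (intro continuous_intros cont)
  \<comment> \<open>Since \<open>monomial_fun a\<close> is \<open>e + p\<close>, orthogonality to
    \<open>a\<close> splits into orthogonality to \<open>p\<close> and to \<open>e\<close>.\<close>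
  have "(\<lambda>x. f x - q' x) \<bullet>\<bullet> p = 0"
    using cont' orth_A p(1) by (rule inner_prod_monomial_span_eq_0)
  moreover have "(\<lambda>x. f x - q' x) \<bullet>\<bullet> e = 0"
    using e_ne cont by (subst eq) (auto simp: c_def)
  moreover have "e \<bullet>\<bullet> (\<lambda>x. f x - q' x) = monomial_fun a \<bullet>\<bullet> (\<lambda>x. f x - q' x) - p \<bullet>\<bullet> (\<lambda>x. f x - q' x)"
    unfolding e_def by (rule inner_prod_diff_left) (intro continuous_intros cont cont')+
  ultimately have "(\<lambda>x. f x - q' x) \<bullet>\<bullet> monomial_fun a = 0"
    using inner_prod_commute by (metis complex_cnj_zero diff_zero)
  then show ?case
    using span_q' orth_A by auto
qed

text \<open>The residual of the monomial \<open>k\<close> after projection to \<open>A\<close> is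
  divided by its norm.\<close>

lemma orthonormal_poly_exists:
  assumes "finite A" "k \<notin> A"
  shows "\<exists>p. is_orthonormal_poly \<sigma> A k p"
proof -
  have "continuous_on bicircle (monomial_fun k)" by (intro continuous_intros)
  then obtain q where q: "monomial_span A q"
    "\<And>a. a \<in> A \<Longrightarrow> (\<lambda>x. monomial_fun k x - q x) \<bullet>\<bullet> monomial_fun a = 0"
    using orthogonal_projection_exists[OF assms(1)] by meson
  obtain u where u: "\<forall>x\<in>bicircle. q x = (\<Sum>l\<in>A. u l * monomial_fun l x)"
    using q by (auto simp: monomial_span_def)
  define e where "e = (\<lambda>x. monomial_fun k x - q x)"
  define s where "s = (\<integral>x. (norm (e x))\<^sup>2 \<partial>\<sigma>)"
  have ee: "e \<bullet>\<bullet> e = of_real s" unfolding s_def by (rule inner_prod_self)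
  have "s \<noteq> 0"
    using monomial_minus_span_norm_nonzero[OF assms q(1)] ee by (auto simp: e_def)
  moreover have "s \<ge> 0"
    unfolding s_def by (rule integral_nonneg_AE) simp
  ultimately have s: "s > 0" by simp
  define c where "c = (1 / sqrt s :: real)"
  have c: "c > 0" "c * c * s = 1" using s by (auto simp: c_def)
  \<comment> \<open>The coefficients of \<open>c * e\<close>: the leading one is
    \<open>c > 0\<close>, the others come from the projection \<open>q\<close>.\<close>
  define v where "v = (\<lambda>l. if l = k then of_real c else if l \<in> A then - of_real c * u l else 0)"
  define p where "p = Abs_poly_mapping v"
  have "finite {l. v l \<noteq> 0}"
    by (rule finite_subset[of _ "insert k A"]) (use assms in \<open>auto simp: v_def\<close>)
  then have lookup_p: "Poly_Mapping.lookup p = v" by (simp add: p_def)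
  have keys: "Poly_Mapping.keys p \<subseteq> insert k A"
    by (auto simp: in_keys_iff lookup_p v_def split: if_splits)
  have ev: "eval_zw p x = of_real c * e x" if "x \<in> bicircle" for x
  proof -
    have "(\<Sum>l\<in>A. v l * monomial_fun l x) = (\<Sum>l\<in>A. - of_real c * (u l * monomial_fun l x))"
      using assms by (intro sum.cong) (auto simp: v_def)
    then show ?thesis
      using eval_zw_eq_sum[OF _ keys, of x] assms that u
      by (simp add: lookup_p v_def e_def sum_distrib_left[symmetric] sum_negf right_diff_distrib)
  qed
  have "eval_zw p \<bullet>\<bullet> eval_zw p = (\<lambda>x. of_real (c * c) * e x) \<bullet>\<bullet> e"
    by (rule inner_prod_cong) (simp add: ev)
  also have "\<dots> = of_real (c * c * s)"
    by (simp add: inner_prod_scale_left ee)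
  finally have "eval_zw p \<bullet>\<bullet> eval_zw p = 1" by (simp add: c)
  moreover have "eval_zw p \<bullet>\<bullet> monomial_fun a = 0" if "a \<in> A" for a
  proof -
    have "eval_zw p \<bullet>\<bullet> monomial_fun a = (\<lambda>x. of_real c * e x) \<bullet>\<bullet> monomial_fun a"
      by (rule inner_prod_cong) (simp add: ev)
    then show ?thesis using q(2)[OF that] by (simp add: inner_prod_scale_left e_def)
  qed
  ultimately show ?thesis
    using keys c unfolding is_orthonormal_poly_def
    by (intro exI[of _ p]) (auto simp: lookup_p v_def)
qed

text \<open>Cross-multiplying by the leading coefficients cancels the term at \<open>k\<close>. What
  is left lies in the span of \<open>A\<close> and is orthogonal to it, hence is 0; the norms then
  fix the factor.\<close>

lemma orthonormal_poly_unique: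
  assumes "finite A" "k \<notin> A" "is_orthonormal_poly \<sigma> A k p" "is_orthonormal_poly \<sigma> A k q"
  shows "p = q"
proof -
  obtain a where a: "Poly_Mapping.lookup p k = of_real a" "a > 0"
    using assms(3) by (auto simp: is_orthonormal_poly_def elim!: Reals_cases)
  obtain b where b: "Poly_Mapping.lookup q k = of_real b" "b > 0"
    using assms(4) by (auto simp: is_orthonormal_poly_def elim!: Reals_cases)
  let ?S = "insert k A"
  have keys: "Poly_Mapping.keys p \<subseteq> ?S" "Poly_Mapping.keys q \<subseteq> ?S"
    using assms by (auto simp: is_orthonormal_poly_def)
  define v where "v = (\<lambda>l. of_real b * Poly_Mapping.lookup p l - of_real a * Poly_Mapping.lookup q l)"
  have vk: "v k = 0" by (simp add: v_def a b)
  have span: "monomial_span ?S (eval_zw p)" "monomial_span ?S (eval_zw q)"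
    using assms keys by (auto intro: monomial_span_eval_zw)
  note cont = span[THEN continuous_on_monomial_span]
  have v0: "v l = 0" if "l \<in> A" for l
  proof (rule monomials_independent[OF assms(1) _ that])
    fix f assume f: "\<And>x. f x = (\<Sum>l\<in>A. v l * monomial_fun l x)"
    have f_eq: "f x = of_real b * eval_zw p x - of_real a * eval_zw q x" for x
    proof -
      have "f x = (\<Sum>l\<in>?S. v l * monomial_fun l x)"
        using assms(1,2) by (simp add: f vk)
      also have "\<dots> = of_real b * eval_zw p x - of_real a * eval_zw q x"
        using assms(1)
        by (subst (1 2) eval_zw_eq_sum[of ?S])
          (simp_all add: keys v_def algebra_simps sum_subtractf sum_distrib_left)
      finally show ?thesis .
    qed
    have f_cont: "continuous_on bicircle f"
      unfolding f_eq[abs_def] by (intro continuous_intros cont)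
    show "f \<bullet>\<bullet> f = 0"
    proof (rule inner_prod_monomial_span_eq_0[OF f_cont])
      show "monomial_span A f" using f by (auto simp: monomial_span_def)
      fix l assume "l \<in> A"
      then show "f \<bullet>\<bullet> monomial_fun l = 0"
        unfolding f_eq[abs_def] using assms(3,4) cont
        by (subst inner_prod_diff_left)
          (auto simp: inner_prod_scale_left is_orthonormal_poly_def intro!: continuous_intros)
    qed
  qed
  have proportional: "of_real b * Poly_Mapping.lookup p l = of_real a * Poly_Mapping.lookup q l" for l
  proof (cases "l \<in> ?S")
    case True
    then have "v l = 0" using vk v0[of l] by auto
    then show ?thesis by (simp add: v_def)
  next
    case False
    then have "Poly_Mapping.lookup p l = 0" "Poly_Mapping.lookup q l = 0"
      using keys by (auto simp: in_keys_iff)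
    then show ?thesis by simp
  qed
  have "of_real b * eval_zw p x = of_real a * eval_zw q x" for x
    using assms(1) by (subst (1 2) eval_zw_eq_sum[of ?S])
      (simp_all add: keys sum_distrib_left mult.assoc[symmetric] proportional)
  \<comment> \<open>Both polynomials have norm 1, so comparing squared norms gives
    \<open>b * b = a * a\<close>, and positivity gives \<open>a = b\<close>.\<close>
  then have "(\<lambda>x. of_real (b * b) * eval_zw p x) \<bullet>\<bullet> eval_zw p
      = (\<lambda>x. of_real (a * a) * eval_zw q x) \<bullet>\<bullet> eval_zw q"
    by (intro inner_prod_cong)
      (metis (no_types, opaque_lifting) complex_cnj_complex_of_real complex_cnj_mult mult.assoc
        mult.commute of_real_mult)
  then have "complex_of_real (b * b) = of_real (a * a)"
    using assms(3,4) unfolding inner_prod_scale_left is_orthonormal_poly_def by simp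
  then have "b * b = a * a" unfolding of_real_eq_iff .
  then have "a = b" using a(2) b(2) by (metis less_asym' mult_strict_mono' less_eq_real_def linorder_neqE)
  then show ?thesis
    using proportional a by (intro poly_mapping_eqI) simp
qed

lemma is_orthonormal_poly_The:
  assumes "finite A" "k \<notin> A"
  shows "is_orthonormal_poly \<sigma> A k (THE p. is_orthonormal_poly \<sigma> A k p)"
  using orthonormal_poly_exists[OF assms] orthonormal_poly_unique[OF assms]
  by (metis theI)

text \<open>In the expansion of \<open>f \<bullet>\<bullet> eval_zw p\<close> only the term at
  \<open>k\<close> survives, and its coefficient is nonzero. This is one step of the last clause of
  \<open>orthonormal_complement\<close>.\<close>

lemma orthonormal_poly_total:
  assumes "finite A" "k \<notin> A" "is_orthonormal_poly \<sigma> A k p" "continuous_on bicircle f"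
    and "\<And>a. a \<in> A \<Longrightarrow> f \<bullet>\<bullet> monomial_fun a = 0" "f \<bullet>\<bullet> eval_zw p = 0"
  shows "f \<bullet>\<bullet> monomial_fun k = 0"
proof -
  let ?c = "Poly_Mapping.lookup p"
  have keys: "Poly_Mapping.keys p \<subseteq> insert k A" and nz: "?c k \<noteq> 0"
    using assms(3) by (auto simp: is_orthonormal_poly_def)
  have "f \<bullet>\<bullet> eval_zw p = f \<bullet>\<bullet> (\<lambda>x. \<Sum>l\<in>insert k A. ?c l * monomial_fun l x)"
    using eval_zw_eq_sum[OF _ keys] assms(1) by (intro inner_prod_cong) simp
  also have "\<dots> = (\<Sum>l\<in>insert k A. cnj (?c l) * (f \<bullet>\<bullet> monomial_fun l))"
    by (intro inner_prod_sum_right continuous_intros assms)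
  also have "\<dots> = cnj (?c k) * (f \<bullet>\<bullet> monomial_fun k)"
    using assms by simp
  finally show ?thesis using assms(6) nz by simp
qed

section \<open>Orthonormal bases of the layers between two exponent grids\<close>

text \<open>The exponents \<open>g 0, g 1, ...\<close> are adjoined to \<open>A\<close> one at a
  time, each bringing one orthonormal polynomial. Injectivity and disjointness make each exponent
  new. The vector \<open>X\<close> lists the polynomials in descending order, as \<open>Phi\<close>
  and \<open>Phi_tilde\<close> do.\<close>

lemma orthonormal_complement_chain:
  assumes fin: "finite A" and inj: "inj g" and disj: "range g \<inter> A = {}"
    and p: "\<And>l. l < r \<Longrightarrow> is_orthonormal_poly \<sigma> (A \<union> g ` {0..<l}) (g l) (p l)"
    and X: "\<And>i. i < r \<Longrightarrow> X i = eval_zw (p (r - 1 - i))"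
  shows "orthonormal_complement \<sigma> A (A \<union> g ` {0..<r}) r X"
proof -
  have span: "monomial_span (A \<union> g ` {0..<t}) (eval_zw (p l))" if "l < t" "l < r" for l t
  proof (rule monomial_span_eval_zw)
    have "Poly_Mapping.keys (p l) \<subseteq> insert (g l) (A \<union> g ` {0..<l})"
      using p[OF that(2)] by (simp add: is_orthonormal_poly_def)
    then show "Poly_Mapping.keys (p l) \<subseteq> A \<union> g ` {0..<t}"
      using that by fastforce
  qed (use fin in simp)
  have orth: "eval_zw (p l) \<bullet>\<bullet> monomial_fun k = 0" if "l < r" "k \<in> A \<union> g ` {0..<l}" for l k
    using p[OF that(1)] that(2) by (simp add: is_orthonormal_poly_def)
  have orth': "eval_zw (p l) \<bullet>\<bullet> eval_zw (p l') = 0" if "l < r" "l' < l" for l l'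
    using that by (intro inner_prod_monomial_span_eq_0[OF continuous_on_monomial_span orth span])
      (auto intro: span)
  have on: "eval_zw (p l) \<bullet>\<bullet> eval_zw (p l') = (if l = l' then 1 else 0)" if "l < r" "l' < r" for l l'
  proof (cases l l' rule: linorder_cases)
    case less
    then show ?thesis
      using orth'[OF that(2) less] inner_prod_commute[of "eval_zw (p l)"] by simp
  next
    case equal
    then show ?thesis using p[OF that(1)] by (simp add: is_orthonormal_poly_def)
  next
    case greater
    then show ?thesis using orth'[OF that(1) greater] by simp
  qed
  have total: "f \<bullet>\<bullet> monomial_fun k = 0"
    if "continuous_on bicircle f" "\<forall>k\<in>A. f \<bullet>\<bullet> monomial_fun k = 0"
      "\<forall>i<r. f \<bullet>\<bullet> X i = 0" "k \<in> A \<union> g ` {0..<r}" for f k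
  proof -
    have X0: "f \<bullet>\<bullet> eval_zw (p l) = 0" if "l < r" for l
    proof -
      have "r - 1 - l < r" "r - 1 - (r - 1 - l) = l" using that by auto
      then show ?thesis using X[of "r - 1 - l"] \<open>\<forall>i<r. f \<bullet>\<bullet> X i = 0\<close> by metis
    qed
    \<comment> \<open>Orthogonality to the monomials spreads along the chain, one exponent per
      induction step.\<close>
    have "\<forall>k\<in>A \<union> g ` {0..<t}. f \<bullet>\<bullet> monomial_fun k = 0" if "t \<le> r" for t
      using that
    proof (induction t)
      case 0
      then show ?case using \<open>\<forall>k\<in>A. f \<bullet>\<bullet> monomial_fun k = 0\<close> by simp
    next
      case (Suc t)
      then have IH: "\<And>k. k \<in> A \<union> g ` {0..<t} \<Longrightarrow> f \<bullet>\<bullet> monomial_fun k = 0" and "t < r" by auto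
      have "g t \<notin> A \<union> g ` {0..<t}" using inj disj by (auto dest: injD)
      then have "f \<bullet>\<bullet> monomial_fun (g t) = 0"
        using orthonormal_poly_total[OF _ _ p[OF \<open>t < r\<close>]] fin IH X0[OF \<open>t < r\<close>]
          \<open>continuous_on bicircle f\<close> by simp
      then show ?case using IH by (auto simp: atLeast0_lessThan_Suc)
    qed
    then show ?thesis using \<open>k \<in> A \<union> g ` {0..<r}\<close> by blast
  qed
  show ?thesis
    unfolding orthonormal_complement_def
  proof (intro conjI allI impI ballI)
    fix i j assume "i < r" "j < r"
    then show "X i \<bullet>\<bullet> X j = (if i = j then 1 else 0)"
      by (simp add: X on) auto
  next
    fix i assume "i < r"
    then show "monomial_span (A \<union> g ` {0..<r}) (X i)"
      by (simp add: X span)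
  next
    fix i k assume "i < r" "k \<in> A"
    then show "X i \<bullet>\<bullet> monomial_fun k = 0"
      by (simp add: X orth)
  qed (use total in blast)
qed

text \<open>Here the chain runs through the exponents \<open>(n, 0)\<close> to
  \<open>(n, m)\<close>; for \<open>Phi_tilde\<close> it runs through \<open>(0, m)\<close> to
  \<open>(n, m)\<close>.\<close>

lemma orthonormal_complement_Phi:
  "orthonormal_complement \<sigma> ({..<n} \<times> {..<Suc m}) ({..<Suc n} \<times> {..<Suc m}) (Suc m) (Phi \<sigma> n m)"
proof -
  have "orthonormal_complement \<sigma> ({0..<n} \<times> {0..m})
      ({0..<n} \<times> {0..m} \<union> (\<lambda>l. (n, l)) ` {0..<Suc m}) (Suc m) (Phi \<sigma> n m)"
  proof (rule orthonormal_complement_chain)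
    fix l :: nat
    have eq: "(\<lambda>l. (n, l)) ` {0..<l} = {n} \<times> {0..<l}" by auto
    show "is_orthonormal_poly \<sigma> ({0..<n} \<times> {0..m} \<union> (\<lambda>l. (n, l)) ` {0..<l}) (n, l) (phi \<sigma> n m l)"
      unfolding phi_def eq by (rule is_orthonormal_poly_The) auto
  qed (auto simp: Phi_def inj_def)
  moreover have "{0..<n} \<times> {0..m} = {..<n} \<times> {..<Suc m}" by auto
  moreover have "{0..<n} \<times> {0..m} \<union> (\<lambda>l. (n, l)) ` {0..<Suc m} = {..<Suc n} \<times> {..<Suc m}"
    by (auto simp: image_iff)
  ultimately show ?thesis by metis
qed

lemma orthonormal_complement_Phi_tilde:
  "orthonormal_complement \<sigma> ({..<Suc n} \<times> {..<m}) ({..<Suc n} \<times> {..<Suc m}) (Suc n) (Phi_tilde \<sigma> n m)"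
proof -
  have "orthonormal_complement \<sigma> ({0..n} \<times> {0..<m})
      ({0..n} \<times> {0..<m} \<union> (\<lambda>l. (l, m)) ` {0..<Suc n}) (Suc n) (Phi_tilde \<sigma> n m)"
  proof (rule orthonormal_complement_chain)
    fix l :: nat
    have eq: "(\<lambda>l. (l, m)) ` {0..<l} = {0..<l} \<times> {m}" by auto
    show "is_orthonormal_poly \<sigma> ({0..n} \<times> {0..<m} \<union> (\<lambda>l. (l, m)) ` {0..<l}) (l, m) (phi_tilde \<sigma> n m l)"
      unfolding phi_tilde_def eq by (rule is_orthonormal_poly_The) auto
  qed (auto simp: Phi_tilde_def inj_def)
  moreover have "{0..n} \<times> {0..<m} = {..<Suc n} \<times> {..<m}" by auto
  moreover have "{0..n} \<times> {0..<m} \<union> (\<lambda>l. (l, m)) ` {0..<Suc n} = {..<Suc n} \<times> {..<Suc m}"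
    by (auto simp: image_iff)
  ultimately show ?thesis by metis
qed

text \<open>With the grid height as parameter, \<open>m = 0\<close> is included: both grids and the
  family are then empty, and the truncated \<open>m - 1\<close> does no harm. This covers the empty
  matrices \<open>K_tilde\<close>; the next lemma does the same for \<open>K\<close>.\<close>

lemma orthonormal_complement_Phi':
  "orthonormal_complement \<sigma> ({..<n} \<times> {..<m}) ({..<Suc n} \<times> {..<m}) m (Phi \<sigma> n (m - 1))"
  using orthonormal_complement_Phi[of n "m - 1"]
  by (cases m) (simp_all add: orthonormal_complement_def)

lemma orthonormal_complement_Phi_tilde':
  "orthonormal_complement \<sigma> ({..<n} \<times> {..<m}) ({..<n} \<times> {..<Suc m}) n (Phi_tilde \<sigma> (n - 1) m)"
  using orthonormal_complement_Phi_tilde[of "n - 1" m]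
  by (cases n) (simp_all add: orthonormal_complement_def)

lemma orthonormal_complement_continuous:
  assumes "orthonormal_complement \<sigma> A B r X" "i < r"
  shows "continuous_on bicircle (X i)"
  using assms continuous_on_monomial_span by (auto simp: orthonormal_complement_def)

section \<open>Expansion in two adjacent layers\<close>

text \<open>A Parseval identity: \<open>X\<close> and \<open>Y\<close> together form an orthonormal
  basis of the complement of \<open>A\<close> in \<open>C\<close>. Only \<open>f\<close> must lie in
  that complement; \<open>g\<close> is any continuous function.\<close>

lemma orthonormal_complement_expansion:
  assumes X: "orthonormal_complement \<sigma> A B r X" and Y: "orthonormal_complement \<sigma> B C s Y"
    and sub: "A \<subseteq> B" "B \<subseteq> C" "finite C"
    and f: "monomial_span C f" "\<And>k. k \<in> A \<Longrightarrow> f \<bullet>\<bullet> monomial_fun k = 0"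
    and g: "continuous_on bicircle g"
  shows "f \<bullet>\<bullet> g = (\<Sum>i=0..<s. (f \<bullet>\<bullet> Y i) * (Y i \<bullet>\<bullet> g)) + (\<Sum>i=0..<r. (f \<bullet>\<bullet> X i) * (X i \<bullet>\<bullet> g))"
proof -
  \<comment> \<open>The remainder of the expansion; its norm turns out to be 0.\<close>
  define e where "e = (\<lambda>x. f x - ((\<Sum>i=0..<s. (f \<bullet>\<bullet> Y i) * Y i x) + (\<Sum>i=0..<r. (f \<bullet>\<bullet> X i) * X i x)))"
  have Xspan: "monomial_span B (X i)" if "i < r" for i
    using X that by (simp add: orthonormal_complement_def)
  have XspanC: "monomial_span C (X i)" if "i < r" for i
    using Xspan[OF that] sub by (rule_tac monomial_span_mono)
  have Yspan: "monomial_span C (Y i)" if "i < s" for i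
    using Y that by (simp add: orthonormal_complement_def)
  note Xcont = orthonormal_complement_continuous[OF X]
  note Ycont = orthonormal_complement_continuous[OF Y]
  note fcont = continuous_on_monomial_span[OF f(1)]
  have XX: "X i \<bullet>\<bullet> X j = (if i = j then 1 else 0)" if "i < r" "j < r" for i j
    using X that by (simp add: orthonormal_complement_def)
  have YY: "Y i \<bullet>\<bullet> Y j = (if i = j then 1 else 0)" if "i < s" "j < s" for i j
    using Y that by (simp add: orthonormal_complement_def)
  have XA: "X i \<bullet>\<bullet> monomial_fun k = 0" if "i < r" "k \<in> A" for i k
    using X that by (simp add: orthonormal_complement_def)
  have YB: "Y i \<bullet>\<bullet> monomial_fun k = 0" if "i < s" "k \<in> B" for i k
    using Y that by (simp add: orthonormal_complement_def)
  have YX: "Y j \<bullet>\<bullet> X i = 0" if "i < r" "j < s" for i j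
    by (rule inner_prod_monomial_span_eq_0[OF Ycont YB Xspan]) (use that in auto)
  have XY: "X i \<bullet>\<bullet> Y j = 0" if "i < r" "j < s" for i j
    using YX[OF that] inner_prod_commute[of "X i"] by simp
  have e_inner: "e \<bullet>\<bullet> h = f \<bullet>\<bullet> h - ((\<Sum>i=0..<s. (f \<bullet>\<bullet> Y i) * (Y i \<bullet>\<bullet> h))
      + (\<Sum>i=0..<r. (f \<bullet>\<bullet> X i) * (X i \<bullet>\<bullet> h)))" if "continuous_on bicircle h" for h
  proof -
    have cont: "continuous_on bicircle (\<lambda>x. \<Sum>i=0..<s. (f \<bullet>\<bullet> Y i) * Y i x)"
        "continuous_on bicircle (\<lambda>x. \<Sum>i=0..<r. (f \<bullet>\<bullet> X i) * X i x)"
      by (auto intro!: continuous_intros Xcont Ycont)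
    have "(\<lambda>x. \<Sum>i=0..<s. (f \<bullet>\<bullet> Y i) * Y i x) \<bullet>\<bullet> h = (\<Sum>i=0..<s. (f \<bullet>\<bullet> Y i) * (Y i \<bullet>\<bullet> h))"
      by (rule inner_prod_sum_left) (use Ycont that in auto)
    moreover have "(\<lambda>x. \<Sum>i=0..<r. (f \<bullet>\<bullet> X i) * X i x) \<bullet>\<bullet> h = (\<Sum>i=0..<r. (f \<bullet>\<bullet> X i) * (X i \<bullet>\<bullet> h))"
      by (rule inner_prod_sum_left) (use Xcont that in auto)
    ultimately show ?thesis
      unfolding e_def inner_prod_diff_left[OF fcont continuous_on_add[OF cont] that]
        inner_prod_add_left[OF cont that] by simp
  qed
  have e_span: "monomial_span C e"
    unfolding e_def using XspanC Yspan
    by (intro monomial_span_diff monomial_span_add monomial_span_sum f) auto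
  note e_cont = continuous_on_monomial_span[OF e_span]
  have eA: "e \<bullet>\<bullet> monomial_fun k = 0" if "k \<in> A" for k
    using that f(2) XA YB[OF _ subsetD[OF sub(1)]] by (subst e_inner) (auto intro!: continuous_intros)
  have eX: "e \<bullet>\<bullet> X i = 0" if "i < r" for i
  proof -
    have "(\<Sum>j=0..<r. (f \<bullet>\<bullet> X j) * (X j \<bullet>\<bullet> X i)) = (\<Sum>j=0..<r. if j = i then f \<bullet>\<bullet> X j else 0)"
      by (rule sum.cong) (auto simp: XX that)
    then show ?thesis
      using that by (simp add: e_inner Xcont YX)
  qed
  have eY: "e \<bullet>\<bullet> Y i = 0" if "i < s" for i
  proof -
    have "(\<Sum>j=0..<s. (f \<bullet>\<bullet> Y j) * (Y j \<bullet>\<bullet> Y i)) = (\<Sum>j=0..<s. if j = i then f \<bullet>\<bullet> Y j else 0)"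
      by (rule sum.cong) (auto simp: YY that)
    then show ?thesis
      using that by (simp add: e_inner Ycont XY)
  qed
  \<comment> \<open>The last clauses for \<open>X\<close> and \<open>Y\<close> carry the
    orthogonality of \<open>e\<close> from \<open>A\<close> to \<open>B\<close> and on to
    \<open>C\<close>. As \<open>e\<close> lies in the span of \<open>C\<close>, it is orthogonal to
    itself.\<close>
  have eB: "\<forall>k\<in>B. e \<bullet>\<bullet> monomial_fun k = 0"
    using X e_cont eA eX by (simp add: orthonormal_complement_def)
  then have eC: "e \<bullet>\<bullet> monomial_fun k = 0" if "k \<in> C" for k
    using that Y e_cont eY by (simp add: orthonormal_complement_def)
  have "e \<bullet>\<bullet> e = 0"
    using e_cont eC e_span by (rule inner_prod_monomial_span_eq_0)
  then have "e \<bullet>\<bullet> g = 0"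
    by (rule inner_prod_self_eq_0[OF e_cont])
  then show ?thesis using e_inner[OF g] by simp
qed

section \<open>Reversal as an antiunitary map\<close>

text \<open>On the unit circle \<open>1 / cnj z\<close> is \<open>z\<close>, so reversal becomes
  conjugation followed by multiplication by a unimodular monomial.\<close>

lemma reverse_vec_bicircle:
  assumes "x \<in> bicircle"
  shows "reverse_vec p q X i x = monomial_fun (p, q) x * cnj (X i x)"
proof -
  have "1 / cnj (fst x) = fst x" "1 / cnj (snd x) = snd x"
    using norm_bicircle[OF assms, THEN mult_cnj_unimodular]
    by (auto simp: field_simps intro: nonzero_divide_eq_eq[THEN iffD2])
  then show ?thesis
    by (simp add: reverse_vec_def monomial_fun_def)
qed

lemma monomial_fun_unimodular:
  assumes "x \<in> bicircle"
  shows "monomial_fun k x * cnj (monomial_fun k x) = 1"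
  using norm_bicircle[OF assms]
  by (intro mult_cnj_unimodular) (simp add: monomial_fun_def norm_mult norm_power)

lemma monomial_fun_reflect:
  assumes "x \<in> bicircle" "k \<in> {..p} \<times> {..q}"
  shows "monomial_fun (p, q) x * cnj (monomial_fun k x) = monomial_fun (p - fst k, q - snd k) x"
proof -
  have "fst x ^ p = fst x ^ (p - fst k) * fst x ^ fst k"
    using assms(2) by (auto simp flip: power_add)
  moreover have "snd x ^ q = snd x ^ (q - snd k) * snd x ^ snd k"
    using assms(2) by (auto simp flip: power_add)
  ultimately have "monomial_fun (p, q) x = monomial_fun (p - fst k, q - snd k) x * monomial_fun k x"
    by (simp add: monomial_fun_def)
  then show ?thesis
    using monomial_fun_unimodular[OF assms(1), of k] by (simp add: mult.assoc)
qed

text \<open>Reversal swaps the arguments of the inner product and reflects the exponents, so each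
  clause transfers. The bounds on \<open>A\<close> and \<open>B\<close> keep the subtractions in
  \<open>\<rho>\<close> free of truncation.\<close>

lemma orthonormal_complement_reverse:
  assumes X: "orthonormal_complement \<sigma> A B r X"
    and sub: "A \<subseteq> {..p} \<times> {..q}" "B \<subseteq> {..p} \<times> {..q}"
  defines "\<rho> \<equiv> \<lambda>k. (p - fst k, q - snd k)"
  shows "orthonormal_complement \<sigma> (\<rho> ` A) (\<rho> ` B) r (reverse_vec p q X)"
proof -
  define R where "R = (\<lambda>f x. monomial_fun (p, q) x * cnj (f x))"
  have R_cont: "continuous_on bicircle (R f)" if "continuous_on bicircle f" for f
    unfolding R_def by (intro continuous_intros that)
  have RR: "R f \<bullet>\<bullet> R g = g \<bullet>\<bullet> f" for f g
  proof (rule inner_prod_cong)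
    fix x assume "x \<in> bicircle"
    have "R f x * cnj (R g x)
        = (monomial_fun (p, q) x * cnj (monomial_fun (p, q) x)) * (g x * cnj (f x))"
      by (simp add: R_def mult_ac)
    then show "R f x * cnj (R g x) = g x * cnj (f x)"
      using monomial_fun_unimodular[OF \<open>x \<in> bicircle\<close>] by simp
  qed
  have R_swap: "R f \<bullet>\<bullet> g = R g \<bullet>\<bullet> f" for f g
    by (rule inner_prod_cong) (simp add: R_def mult_ac)
  have R_mono: "R (monomial_fun k) x = monomial_fun (\<rho> k) x" if "x \<in> bicircle" "k \<in> A \<union> B" for k x
    unfolding R_def \<rho>_def using that sub by (intro monomial_fun_reflect) auto
  have rev: "reverse_vec p q X i x = R (X i) x" if "x \<in> bicircle" for i x
    using that by (simp add: reverse_vec_bicircle R_def)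
  have rev_left: "reverse_vec p q X i \<bullet>\<bullet> g = R (X i) \<bullet>\<bullet> g" for i g
    by (rule inner_prod_cong) (simp add: rev)
  have rev_right: "g \<bullet>\<bullet> reverse_vec p q X i = g \<bullet>\<bullet> R (X i)" for i g
    by (rule inner_prod_cong) (simp add: rev)
  have mono_right: "f \<bullet>\<bullet> monomial_fun (\<rho> k) = f \<bullet>\<bullet> R (monomial_fun k)" if "k \<in> A \<union> B" for f k
    by (rule inner_prod_cong) (simp add: R_mono[OF _ that])
  \<comment> \<open>Conditions on \<open>f\<close> against reversed functions become conditions on
    \<open>R f\<close> against the original ones, so the last clause for \<open>X\<close> applies to
    \<open>R f\<close>.\<close>
  have flip: "f \<bullet>\<bullet> R g = cnj (R f \<bullet>\<bullet> g)" for f g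
    using inner_prod_commute[of f "R g"] R_swap[of f g] by simp
  have fin: "finite B" using sub by (rule_tac finite_subset) auto
  show ?thesis
    unfolding orthonormal_complement_def
  proof (intro conjI allI impI ballI)
    fix i assume "i < r"
    then have "monomial_span B (X i)"
      using X by (simp add: orthonormal_complement_def)
    then obtain v where v: "\<forall>x\<in>bicircle. X i x = (\<Sum>k\<in>B. v k * monomial_fun k x)"
      by (auto simp: monomial_span_def)
    have eq: "reverse_vec p q X i x = (\<Sum>k\<in>B. cnj (v k) * monomial_fun (\<rho> k) x)"
      if "x \<in> bicircle" for x
    proof -
      have "reverse_vec p q X i x = (\<Sum>k\<in>B. cnj (v k) * R (monomial_fun k) x)"
        using that v by (simp add: rev R_def sum_distrib_left mult_ac)
      also have "\<dots> = (\<Sum>k\<in>B. cnj (v k) * monomial_fun (\<rho> k) x)"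
        using that by (intro sum.cong) (simp_all add: R_mono)
      finally show ?thesis .
    qed
    have "monomial_span (\<rho> ` B) (\<lambda>x. \<Sum>k\<in>B. cnj (v k) * monomial_fun (\<rho> k) x)"
      using fin by (intro monomial_span_sum monomial_span_monomial) auto
    then show "monomial_span (\<rho> ` B) (reverse_vec p q X i)"
      using eq by (rule monomial_span_cong)
  next
    fix i k assume "i < r" "k \<in> \<rho> ` A"
    then obtain a where "a \<in> A" "k = \<rho> a" by auto
    then have "reverse_vec p q X i \<bullet>\<bullet> monomial_fun k = monomial_fun a \<bullet>\<bullet> X i"
      by (simp add: rev_left mono_right RR)
    also have "\<dots> = cnj (X i \<bullet>\<bullet> monomial_fun a)"
      by (rule inner_prod_commute)
    also have "\<dots> = 0"
      using X \<open>i < r\<close> \<open>a \<in> A\<close> by (simp add: orthonormal_complement_def)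
    finally show "reverse_vec p q X i \<bullet>\<bullet> monomial_fun k = 0" .
  next
    fix i j assume "i < r" "j < r"
    then show "reverse_vec p q X i \<bullet>\<bullet> reverse_vec p q X j = (if i = j then 1 else 0)"
      using X by (auto simp: rev_left rev_right RR orthonormal_complement_def)
  next
    fix f k
    assume f: "continuous_on bicircle f" "\<forall>k\<in>\<rho> ` A. f \<bullet>\<bullet> monomial_fun k = 0"
      "\<forall>i<r. f \<bullet>\<bullet> reverse_vec p q X i = 0" and "k \<in> \<rho> ` B"
    have "\<forall>a\<in>A. R f \<bullet>\<bullet> monomial_fun a = 0"
      using f(2) by (simp add: mono_right flip)
    moreover have "\<forall>i<r. R f \<bullet>\<bullet> X i = 0"
      using f(3) by (simp add: rev_right flip)
    ultimately have "\<forall>b\<in>B. R f \<bullet>\<bullet> monomial_fun b = 0"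
      using X R_cont[OF f(1)] by (simp add: orthonormal_complement_def)
    then show "f \<bullet>\<bullet> monomial_fun k = 0"
      using \<open>k \<in> \<rho> ` B\<close> by (auto simp: mono_right flip)
  qed
qed

text \<open>The common core of both recurrences. First \<open>f\<close> is expanded in
  \<open>b\<close> and \<open>c\<close>; the \<open>c\<close> terms are already final because
  \<open>\<tau>\<close> turns \<open>c\<close> into \<open>c'\<close>. Then \<open>g\<close> is
  expanded in \<open>b\<close> and \<open>c'\<close>, where the \<open>c'\<close> terms vanish since
  \<open>b\<close> is orthogonal to \<open>c\<close>.\<close>

lemma inner_prod_reverse_expansion:
  assumes c: "orthonormal_complement \<sigma> A B t c" and c': "orthonormal_complement \<sigma> A' B t c'"
    and b: "orthonormal_complement \<sigma> B C s b"
    and sub: "A \<subseteq> B" "A' \<subseteq> B" "B \<subseteq> C" "finite C"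
    and f: "monomial_span C f" "\<And>k. k \<in> A \<Longrightarrow> f \<bullet>\<bullet> monomial_fun k = 0"
    and g: "monomial_span C g" "\<And>k. k \<in> A' \<Longrightarrow> g \<bullet>\<bullet> monomial_fun k = 0"
    and \<tau>: "continuous_on bicircle \<tau>" "\<And>x. x \<in> bicircle \<Longrightarrow> norm (\<tau> x) = 1"
    and reverse: "\<And>k x. k < t \<Longrightarrow> x \<in> bicircle \<Longrightarrow> c' k x = \<tau> x * cnj (c k x)"
  shows "f \<bullet>\<bullet> (\<lambda>x. \<tau> x * cnj (g x)) =
    (\<Sum>j=0..<s. (\<Sum>i=0..<s. (f \<bullet>\<bullet> b i) * (b i \<bullet>\<bullet> (\<lambda>x. \<tau> x * cnj (b j x)))) * (g \<bullet>\<bullet> b j))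
    + (\<Sum>k=0..<t. (f \<bullet>\<bullet> c k) * (g \<bullet>\<bullet> c' k))"
proof -
  \<comment> \<open>\<open>?R\<close> is antiunitary with \<open>\<langle>h, ?R h'\<rangle> = \<langle>h', ?R h\<rangle>\<close> and maps the \<open>c k\<close> to the \<open>c' k\<close>.\<close>
  let ?R = "\<lambda>f x. \<tau> x * cnj (f x)"
  have R_swap: "h \<bullet>\<bullet> ?R h' = h' \<bullet>\<bullet> ?R h" for h h'
    by (rule inner_prod_cong) (simp add: mult_ac)
  have R_cont: "continuous_on bicircle (?R h)" if "continuous_on bicircle h" for h
    by (intro continuous_intros that \<tau>)
  have gc: "c k \<bullet>\<bullet> ?R g = g \<bullet>\<bullet> c' k" if "k < t" for k
    unfolding R_swap[of "c k"] by (rule inner_prod_cong) (simp add: reverse that)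
  have cb: "c' k \<bullet>\<bullet> ?R (b i) = 0" if "k < t" "i < s" for k i
  proof -
    have "c' k \<bullet>\<bullet> ?R (b i) = b i \<bullet>\<bullet> c k"
    proof (rule inner_prod_cong)
      fix x assume x: "x \<in> bicircle"
      have "c' k x * cnj (?R (b i) x) = (\<tau> x * cnj (\<tau> x)) * (b i x * cnj (c k x))"
        by (simp add: reverse x that mult_ac)
      then show "c' k x * cnj (?R (b i) x) = b i x * cnj (c k x)"
        using mult_cnj_unimodular[OF \<tau>(2)[OF x]] by simp
    qed
    also have "\<dots> = 0"
    proof (rule inner_prod_monomial_span_eq_0)
      show "continuous_on bicircle (b i)"
        using orthonormal_complement_continuous[OF b] that by simp
      show "monomial_span B (c k)"
        using c that unfolding orthonormal_complement_def by simp
      show "b i \<bullet>\<bullet> monomial_fun l = 0" if "l \<in> B" for l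
        using b that \<open>i < s\<close> unfolding orthonormal_complement_def by simp
    qed
    finally show ?thesis .
  qed
  have gb: "b i \<bullet>\<bullet> ?R g = (\<Sum>j=0..<s. (g \<bullet>\<bullet> b j) * (b i \<bullet>\<bullet> ?R (b j)))" if "i < s" for i
  proof -
    have "b i \<bullet>\<bullet> ?R g = g \<bullet>\<bullet> ?R (b i)" by (rule R_swap)
    also have "\<dots> = (\<Sum>j=0..<s. (g \<bullet>\<bullet> b j) * (b j \<bullet>\<bullet> ?R (b i)))
        + (\<Sum>k=0..<t. (g \<bullet>\<bullet> c' k) * (c' k \<bullet>\<bullet> ?R (b i)))"
      by (rule orthonormal_complement_expansion[OF c' b sub(2-4) g])
        (assumption | rule R_cont orthonormal_complement_continuous[OF b that])+
    also have "(\<Sum>k=0..<t. (g \<bullet>\<bullet> c' k) * (c' k \<bullet>\<bullet> ?R (b i))) = 0"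
      using that by (simp add: cb)
    \<comment> \<open>The matrix of the \<open>b i \<bullet>\<bullet> ?R (b j)\<close> is symmetric;
      the swap puts the indices in the order of the matrix product.\<close>
    also have "(\<Sum>j=0..<s. (g \<bullet>\<bullet> b j) * (b j \<bullet>\<bullet> ?R (b i)))
        = (\<Sum>j=0..<s. (g \<bullet>\<bullet> b j) * (b i \<bullet>\<bullet> ?R (b j)))"
      by (intro sum.cong refl arg_cong2[where f = "(*)"] R_swap)
    finally show ?thesis by simp
  qed
  have "f \<bullet>\<bullet> ?R g = (\<Sum>i=0..<s. (f \<bullet>\<bullet> b i) * (b i \<bullet>\<bullet> ?R g)) + (\<Sum>k=0..<t. (f \<bullet>\<bullet> c k) * (c k \<bullet>\<bullet> ?R g))"
    by (rule orthonormal_complement_expansion[OF c b sub(1,3,4) f])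
      (assumption | rule R_cont continuous_on_monomial_span[OF g(1)])+
  also have "(\<Sum>i=0..<s. (f \<bullet>\<bullet> b i) * (b i \<bullet>\<bullet> ?R g))
      = (\<Sum>i=0..<s. \<Sum>j=0..<s. (f \<bullet>\<bullet> b i) * (b i \<bullet>\<bullet> ?R (b j)) * (g \<bullet>\<bullet> b j))"
    by (rule sum.cong[OF refl], subst gb) (simp_all add: sum_distrib_left mult_ac)
  also have "\<dots> = (\<Sum>j=0..<s. (\<Sum>i=0..<s. (f \<bullet>\<bullet> b i) * (b i \<bullet>\<bullet> ?R (b j))) * (g \<bullet>\<bullet> b j))"
    unfolding sum_distrib_right by (rule sum.swap)
  also have "(\<Sum>k=0..<t. (f \<bullet>\<bullet> c k) * (c k \<bullet>\<bullet> ?R g)) = (\<Sum>k=0..<t. (f \<bullet>\<bullet> c k) * (g \<bullet>\<bullet> c' k))"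
    by (simp add: gc)
  finally show ?thesis .
qed

section \<open>Multiplication by a coordinate and reflection of exponent grids\<close>

lemma monomial_span_times:
  assumes "monomial_span S f" "\<And>k. k \<in> S \<Longrightarrow> monomial_span T (\<lambda>x. u x * monomial_fun k x)"
  shows "monomial_span T (\<lambda>x. u x * f x)"
proof -
  obtain v where v: "\<forall>x\<in>bicircle. f x = (\<Sum>k\<in>S. v k * monomial_fun k x)"
    using assms by (auto simp: monomial_span_def)
  have eq: "u x * f x = (\<Sum>k\<in>S. v k * (u x * monomial_fun k x))" if "x \<in> bicircle" for x
    using that v by (simp add: sum_distrib_left mult_ac)
  have "monomial_span T (\<lambda>x. \<Sum>k\<in>S. v k * (u x * monomial_fun k x))"
    by (intro monomial_span_sum assms)
  then show ?thesis
    using eq by (rule monomial_span_cong)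
qed

lemma z_times_monomial_fun: "fst x * monomial_fun k x = monomial_fun (Suc (fst k), snd k) x"
  by (simp add: monomial_fun_def)

lemma w_times_monomial_fun: "snd x * monomial_fun k x = monomial_fun (fst k, Suc (snd k)) x"
  by (simp add: monomial_fun_def)

text \<open>The unimodular factor cancels its conjugate, so multiplying by a coordinate shifts the
  set of exponents to which a function is orthogonal.\<close>

lemma inner_prod_z_times:
  "z_times X i \<bullet>\<bullet> monomial_fun (Suc j, l) = X i \<bullet>\<bullet> monomial_fun (j, l)"
proof (rule inner_prod_cong)
  fix x assume "x \<in> bicircle"
  then have "fst x * cnj (fst x) = 1"
    using norm_bicircle mult_cnj_unimodular by blast
  moreover have "z_times X i x * cnj (monomial_fun (Suc j, l) x)
      = (fst x * cnj (fst x)) * (X i x * cnj (monomial_fun (j, l) x))"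
    by (simp add: z_times_def monomial_fun_def)
  ultimately show "z_times X i x * cnj (monomial_fun (Suc j, l) x) = X i x * cnj (monomial_fun (j, l) x)"
    by simp
qed

lemma inner_prod_w_times:
  "w_times X i \<bullet>\<bullet> monomial_fun (j, Suc l) = X i \<bullet>\<bullet> monomial_fun (j, l)"
proof (rule inner_prod_cong)
  fix x assume "x \<in> bicircle"
  then have "snd x * cnj (snd x) = 1"
    using norm_bicircle mult_cnj_unimodular by blast
  moreover have "w_times X i x * cnj (monomial_fun (j, Suc l) x)
      = (snd x * cnj (snd x)) * (X i x * cnj (monomial_fun (j, l) x))"
    by (simp add: w_times_def monomial_fun_def)
  ultimately show "w_times X i x * cnj (monomial_fun (j, Suc l) x) = X i x * cnj (monomial_fun (j, l) x)"
    by simp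
qed

text \<open>The reflection is an involution of the grid, hence onto; for \<open>n = 0\<close> the
  grid is empty, so the truncated \<open>n - 1\<close> is harmless.\<close>

lemma reflect_grid_first:
  fixes n m :: nat
  shows "(\<lambda>k. (n - 1 - fst k, m - snd k)) ` ({..<n} \<times> {..<Suc m}) = {..<n} \<times> {..<Suc m}"
proof -
  have "k = (\<lambda>k. (n - 1 - fst k, m - snd k)) (n - 1 - fst k, m - snd k)"
    if "k \<in> {..<n} \<times> {..<Suc m}" for k
  proof -
    have "fst k \<le> n - 1" "snd k \<le> m" using that by auto
    then show ?thesis by (simp add: prod_eq_iff)
  qed
  then show ?thesis by (fastforce simp: image_iff)
qed

lemma reflect_grid_second:
  fixes n m :: nat
  shows "(\<lambda>k. (n - fst k, m - 1 - snd k)) ` ({..<Suc n} \<times> {..<m}) = {..<Suc n} \<times> {..<m}"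
proof -
  have "k = (\<lambda>k. (n - fst k, m - 1 - snd k)) (n - fst k, m - 1 - snd k)"
    if "k \<in> {..<Suc n} \<times> {..<m}" for k
  proof -
    have "fst k \<le> n" "snd k \<le> m - 1" using that by auto
    then show ?thesis by (simp add: prod_eq_iff)
  qed
  then show ?thesis by (fastforce simp: image_iff)
qed

section \<open>The two recurrences\<close>

lemma E_hat_recurrence:
  "E_hat \<sigma> (Suc n) m =
    Gam \<sigma> n (Suc m) * E_hat \<sigma> (Suc n) (Suc m) * transpose_mat (Gam1 \<sigma> n (Suc m))
    + K \<sigma> n (Suc m) * transpose_mat (K1 \<sigma> n (Suc m))"
proof -
  define a where "a = Phi \<sigma> n m"
  define b where "b = Phi \<sigma> n (Suc m)"
  define c where "c = Phi_tilde \<sigma> (n - 1) (Suc m)"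
  define c' where "c' = reverse_vec (n - 1) (Suc m) c"
  \<comment> \<open>On the bicircle this is \<open>z^(n-1) w^(m+1)\<close>, the factor that reverses
    \<open>c\<close>; the conjugate avoids a negative exponent at \<open>n = 0\<close>.\<close>
  define \<tau> where "\<tau> = (\<lambda>x. cnj (fst x) * monomial_fun (n, Suc m) x)"
  let ?\<rho> = "\<lambda>k. (n - 1 - fst k, Suc m - snd k)"
  let ?A = "{..<n} \<times> {..<Suc m}"
  let ?B = "{..<n} \<times> {..<Suc (Suc m)}"
  let ?C = "{..<Suc n} \<times> {..<Suc (Suc m)}"
  have a: "orthonormal_complement \<sigma> ?A ({..<Suc n} \<times> {..<Suc m}) (Suc m) a"
    unfolding a_def by (rule orthonormal_complement_Phi)
  have b: "orthonormal_complement \<sigma> ?B ?C (Suc (Suc m)) b"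
    unfolding b_def by (rule orthonormal_complement_Phi)
  have c: "orthonormal_complement \<sigma> ?A ?B n c"
    unfolding c_def by (rule orthonormal_complement_Phi_tilde')
  have "orthonormal_complement \<sigma> (?\<rho> ` ?A) (?\<rho> ` ?B) n c'"
    unfolding c'_def by (rule orthonormal_complement_reverse[OF c]) auto
  then have c': "orthonormal_complement \<sigma> (?\<rho> ` ?A) ?B n c'"
    unfolding reflect_grid_first .
  \<comment> \<open>Reflecting \<open>?A\<close> at height \<open>Suc m\<close> gives
    \<open>?A\<close> raised by one power of \<open>w\<close>, and \<open>w_times a\<close> is
    orthogonal to exactly such monomials.\<close>
  have \<rho>_A: "?\<rho> ` ?A \<subseteq> ?B" "\<And>k. k \<in> ?\<rho> ` ?A \<Longrightarrow> \<exists>j l. k = (j, Suc l) \<and> (j, l) \<in> ?A"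
    by (auto simp: Suc_diff_le)
  have a_span: "monomial_span ({..<Suc n} \<times> {..<Suc m}) (a i)" if "i < Suc m" for i
    using a that by (simp add: orthonormal_complement_def)
  \<comment> \<open>Moving \<open>cnj (fst x)\<close> to the left argument yields the entries of
    \<open>E_hat \<sigma> (Suc n) (Suc m)\<close>.\<close>
  have \<tau>_b: "b i \<bullet>\<bullet> (\<lambda>x. \<tau> x * cnj (b j x)) = z_times b i \<bullet>\<bullet> reverse_vec n (Suc m) b j" for i j
    by (rule inner_prod_cong) (simp add: reverse_vec_bicircle \<tau>_def z_times_def mult_ac)
  have key: "z_times a i \<bullet>\<bullet> reverse_vec n m a l =
      (\<Sum>j=0..<Suc (Suc m). (\<Sum>i'=0..<Suc (Suc m). (a i \<bullet>\<bullet> b i')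
          * (z_times b i' \<bullet>\<bullet> reverse_vec n (Suc m) b j)) * (w_times a l \<bullet>\<bullet> b j))
      + (\<Sum>k=0..<n. (a i \<bullet>\<bullet> c k) * (w_times a l \<bullet>\<bullet> c' k))"
    if "i < Suc m" "l < Suc m" for i l
  proof -
    \<comment> \<open>The extra power of \<open>w\<close> in \<open>\<tau>\<close> cancels the
      conjugated factor from \<open>w_times a l\<close>.\<close>
    have "z_times a i \<bullet>\<bullet> reverse_vec n m a l = a i \<bullet>\<bullet> (\<lambda>x. \<tau> x * cnj (w_times a l x))"
    proof (rule inner_prod_cong)
      fix x assume x: "x \<in> bicircle"
      have "a i x * cnj (\<tau> x * cnj (w_times a l x))
          = (snd x * cnj (snd x)) * (z_times a i x * cnj (reverse_vec n m a l x))"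
        by (simp add: \<tau>_def reverse_vec_bicircle[OF x] monomial_fun_def z_times_def w_times_def mult_ac)
      then show "z_times a i x * cnj (reverse_vec n m a l x) = a i x * cnj (\<tau> x * cnj (w_times a l x))"
        using mult_cnj_unimodular[OF norm_bicircle(2)[OF x]] by simp
    qed
    also have "\<dots> = (\<Sum>j=0..<Suc (Suc m). (\<Sum>i'=0..<Suc (Suc m). (a i \<bullet>\<bullet> b i')
          * (b i' \<bullet>\<bullet> (\<lambda>x. \<tau> x * cnj (b j x)))) * (w_times a l \<bullet>\<bullet> b j))
      + (\<Sum>k=0..<n. (a i \<bullet>\<bullet> c k) * (w_times a l \<bullet>\<bullet> c' k))"
    proof (rule inner_prod_reverse_expansion[OF c c' b _ \<rho>_A(1)])
      show "monomial_span ?C (a i)"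
        using a_span[OF that(1)] by (rule monomial_span_mono) auto
      show "monomial_span ?C (w_times a l)"
        unfolding w_times_def[abs_def]
        using a_span[OF that(2)] by (rule monomial_span_times)
          (auto simp: w_times_monomial_fun intro!: monomial_span_monomial)
      show "a i \<bullet>\<bullet> monomial_fun k = 0" if "k \<in> ?A" for k
        using a that \<open>i < Suc m\<close> unfolding orthonormal_complement_def by blast
      show "w_times a l \<bullet>\<bullet> monomial_fun k = 0" if k: "k \<in> ?\<rho> ` ?A" for k
      proof -
        obtain j j' where "k = (j, Suc j')" "(j, j') \<in> ?A"
          using \<rho>_A(2)[OF k] by blast
        then show ?thesis
          using a \<open>l < Suc m\<close> unfolding orthonormal_complement_def by (simp add: inner_prod_w_times)
      qed
      show "continuous_on bicircle \<tau>"
        unfolding \<tau>_def by (intro continuous_intros)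
      show "norm (\<tau> x) = 1" if "x \<in> bicircle" for x
        using norm_bicircle[OF that] by (simp add: \<tau>_def monomial_fun_def norm_mult norm_power)
      \<comment> \<open>Here \<open>k < n\<close> excludes \<open>n = 0\<close>, so
        \<open>n - 1\<close> is a true predecessor.\<close>
      show "c' k x = \<tau> x * cnj (c k x)" if "k < n" "x \<in> bicircle" for k x
      proof -
        have "fst x ^ n = fst x * fst x ^ (n - 1)"
          using that(1) by (cases n) auto
        then have "\<tau> x * cnj (c k x) = (fst x * cnj (fst x)) * c' k x"
          by (simp add: \<tau>_def c'_def reverse_vec_bicircle[OF that(2)] monomial_fun_def mult_ac)
        then show ?thesis
          using mult_cnj_unimodular[OF norm_bicircle(1)[OF that(2)]] by simp
      qed
    qed auto
    finally show ?thesis unfolding \<tau>_b .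
  qed
  show ?thesis
    unfolding E_hat_def Gam_def Gam1_def K_def K1_def inner_mat_def
    by (rule eq_matI)
      (simp_all add: scalar_prod_def key c_def c'_def del: sum.op_ivl_Suc flip: a_def b_def)
qed

text \<open>The same argument with the coordinates interchanged; the empty product now occurs at
  \<open>m = 0\<close>.\<close>

lemma E_hat_tilde_recurrence:
  "E_hat_tilde \<sigma> n (Suc m) =
    Gam_tilde \<sigma> (Suc n) m * E_hat_tilde \<sigma> (Suc n) (Suc m) * transpose_mat (Gam1_tilde \<sigma> (Suc n) m)
    + K_tilde \<sigma> (Suc n) m * transpose_mat (K1_tilde \<sigma> (Suc n) m)"
proof -
  define a where "a = Phi_tilde \<sigma> n m"
  define b where "b = Phi_tilde \<sigma> (Suc n) m"
  define c where "c = Phi \<sigma> (Suc n) (m - 1)"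
  define c' where "c' = reverse_vec (Suc n) (m - 1) c"
  \<comment> \<open>On the bicircle this is \<open>z^(n+1) w^(m-1)\<close>, which reverses the new
    \<open>c\<close>.\<close>
  define \<tau> where "\<tau> = (\<lambda>x. cnj (snd x) * monomial_fun (Suc n, m) x)"
  let ?\<rho> = "\<lambda>k. (Suc n - fst k, m - 1 - snd k)"
  let ?A = "{..<Suc n} \<times> {..<m}"
  let ?B = "{..<Suc (Suc n)} \<times> {..<m}"
  let ?C = "{..<Suc (Suc n)} \<times> {..<Suc m}"
  have a: "orthonormal_complement \<sigma> ?A ({..<Suc n} \<times> {..<Suc m}) (Suc n) a"
    unfolding a_def by (rule orthonormal_complement_Phi_tilde)
  have b: "orthonormal_complement \<sigma> ?B ?C (Suc (Suc n)) b"
    unfolding b_def by (rule orthonormal_complement_Phi_tilde)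
  have c: "orthonormal_complement \<sigma> ?A ?B m c"
    unfolding c_def by (rule orthonormal_complement_Phi')
  have "orthonormal_complement \<sigma> (?\<rho> ` ?A) (?\<rho> ` ?B) m c'"
    unfolding c'_def by (rule orthonormal_complement_reverse[OF c]) auto
  then have c': "orthonormal_complement \<sigma> (?\<rho> ` ?A) ?B m c'"
    unfolding reflect_grid_second .
  \<comment> \<open>Now the reflected \<open>?A\<close> is \<open>?A\<close> shifted by one power of
    \<open>z\<close>, matching \<open>z_times a\<close>.\<close>
  have \<rho>_A: "?\<rho> ` ?A \<subseteq> ?B" "\<And>k. k \<in> ?\<rho> ` ?A \<Longrightarrow> \<exists>j l. k = (Suc j, l) \<and> (j, l) \<in> ?A"
    by (auto simp: Suc_diff_le)
  have a_span: "monomial_span ({..<Suc n} \<times> {..<Suc m}) (a i)" if "i < Suc n" for i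
    using a that by (simp add: orthonormal_complement_def)
  have \<tau>_b: "b i \<bullet>\<bullet> (\<lambda>x. \<tau> x * cnj (b j x)) = w_times b i \<bullet>\<bullet> reverse_vec (Suc n) m b j" for i j
    by (rule inner_prod_cong) (simp add: reverse_vec_bicircle \<tau>_def w_times_def mult_ac)
  have key: "w_times a i \<bullet>\<bullet> reverse_vec n m a l =
      (\<Sum>j=0..<Suc (Suc n). (\<Sum>i'=0..<Suc (Suc n). (a i \<bullet>\<bullet> b i')
          * (w_times b i' \<bullet>\<bullet> reverse_vec (Suc n) m b j)) * (z_times a l \<bullet>\<bullet> b j))
      + (\<Sum>k=0..<m. (a i \<bullet>\<bullet> c k) * (z_times a l \<bullet>\<bullet> c' k))"
    if "i < Suc n" "l < Suc n" for i l
  proof -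
    have "w_times a i \<bullet>\<bullet> reverse_vec n m a l = a i \<bullet>\<bullet> (\<lambda>x. \<tau> x * cnj (z_times a l x))"
    proof (rule inner_prod_cong)
      fix x assume x: "x \<in> bicircle"
      have "a i x * cnj (\<tau> x * cnj (z_times a l x))
          = (fst x * cnj (fst x)) * (w_times a i x * cnj (reverse_vec n m a l x))"
        by (simp add: \<tau>_def reverse_vec_bicircle[OF x] monomial_fun_def w_times_def z_times_def mult_ac)
      then show "w_times a i x * cnj (reverse_vec n m a l x) = a i x * cnj (\<tau> x * cnj (z_times a l x))"
        using mult_cnj_unimodular[OF norm_bicircle(1)[OF x]] by simp
    qed
    also have "\<dots> = (\<Sum>j=0..<Suc (Suc n). (\<Sum>i'=0..<Suc (Suc n). (a i \<bullet>\<bullet> b i')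
          * (b i' \<bullet>\<bullet> (\<lambda>x. \<tau> x * cnj (b j x)))) * (z_times a l \<bullet>\<bullet> b j))
      + (\<Sum>k=0..<m. (a i \<bullet>\<bullet> c k) * (z_times a l \<bullet>\<bullet> c' k))"
    proof (rule inner_prod_reverse_expansion[OF c c' b _ \<rho>_A(1)])
      show "monomial_span ?C (a i)"
        using a_span[OF that(1)] by (rule monomial_span_mono) auto
      show "monomial_span ?C (z_times a l)"
        unfolding z_times_def[abs_def]
        using a_span[OF that(2)] by (rule monomial_span_times)
          (auto simp: z_times_monomial_fun intro!: monomial_span_monomial)
      show "a i \<bullet>\<bullet> monomial_fun k = 0" if "k \<in> ?A" for k
        using a that \<open>i < Suc n\<close> unfolding orthonormal_complement_def by blast
      show "z_times a l \<bullet>\<bullet> monomial_fun k = 0" if k: "k \<in> ?\<rho> ` ?A" for k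
      proof -
        obtain j j' where "k = (Suc j, j')" "(j, j') \<in> ?A"
          using \<rho>_A(2)[OF k] by blast
        then show ?thesis
          using a \<open>l < Suc n\<close> unfolding orthonormal_complement_def by (simp add: inner_prod_z_times)
      qed
      show "continuous_on bicircle \<tau>"
        unfolding \<tau>_def by (intro continuous_intros)
      show "norm (\<tau> x) = 1" if "x \<in> bicircle" for x
        using norm_bicircle[OF that] by (simp add: \<tau>_def monomial_fun_def norm_mult norm_power)
      show "c' k x = \<tau> x * cnj (c k x)" if "k < m" "x \<in> bicircle" for k x
      proof -
        have "snd x ^ m = snd x * snd x ^ (m - 1)"
          using that(1) by (cases m) auto
        then have "\<tau> x * cnj (c k x) = (snd x * cnj (snd x)) * c' k x"
          by (simp add: \<tau>_def c'_def reverse_vec_bicircle[OF that(2)] monomial_fun_def mult_ac)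
        then show ?thesis
          using mult_cnj_unimodular[OF norm_bicircle(2)[OF that(2)]] by simp
      qed
    qed auto
    finally show ?thesis unfolding \<tau>_b .
  qed
  show ?thesis
    unfolding E_hat_tilde_def Gam_tilde_def Gam1_tilde_def K_tilde_def K1_tilde_def inner_mat_def
    by (rule eq_matI)
      (simp_all add: scalar_prod_def key c_def c'_def del: sum.op_ivl_Suc flip: a_def b_def)
qed

end

theorem lemma3p1:
  fixes \<sigma> :: "(complex \<times> complex) measure"
  assumes "admissible_measure \<sigma>"
  shows "(\<forall>n m. 0 < n \<longrightarrow>
      E_hat \<sigma> n m =
        Gam \<sigma> (n - 1) (m + 1) * E_hat \<sigma> n (m + 1) * transpose_mat (Gam1 \<sigma> (n - 1) (m + 1))
        + K \<sigma> (n - 1) (m + 1) * transpose_mat (K1 \<sigma> (n - 1) (m + 1))) \<and>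
    (\<forall>n m. 0 < m \<longrightarrow>
      E_hat_tilde \<sigma> n m =
        Gam_tilde \<sigma> (n + 1) (m - 1) * E_hat_tilde \<sigma> (n + 1) m
          * transpose_mat (Gam1_tilde \<sigma> (n + 1) (m - 1))
        + K_tilde \<sigma> (n + 1) (m - 1) * transpose_mat (K1_tilde \<sigma> (n + 1) (m - 1)))"
proof (intro conjI allI impI)
  fix n m :: nat
  assume "0 < n"
  then obtain n' where "n = Suc n'" by (cases n) auto
  then show "E_hat \<sigma> n m =
      Gam \<sigma> (n - 1) (m + 1) * E_hat \<sigma> n (m + 1) * transpose_mat (Gam1 \<sigma> (n - 1) (m + 1))
      + K \<sigma> (n - 1) (m + 1) * transpose_mat (K1 \<sigma> (n - 1) (m + 1))"
    using E_hat_recurrence[OF assms, of n' m] by simp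
next
  fix n m :: nat
  assume "0 < m"
  then obtain m' where "m = Suc m'" by (cases m) auto
  then show "E_hat_tilde \<sigma> n m =
      Gam_tilde \<sigma> (n + 1) (m - 1) * E_hat_tilde \<sigma> (n + 1) m
        * transpose_mat (Gam1_tilde \<sigma> (n + 1) (m - 1))
      + K_tilde \<sigma> (n + 1) (m - 1) * transpose_mat (K1_tilde \<sigma> (n + 1) (m - 1))"
    using E_hat_tilde_recurrence[OF assms, of n m'] by simp
qed

end
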